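(* Let $m,n$ be positive integers with $n\ge 5$, let $A$ be an integral $m\times n$ matrix, and let $\ell_1,w_1\in\mathbb{Z}^m$, $\ell_2,w_2\in\mathbb{Z}^n$ with $w_2>\ell_2$ (componentwise). (1) If $Q_R$ is computed using RKZ reduction and is nonempty, then $$\operatorname{width}(e_n,Q_R)\le\frac{\sqrt{n}\,\|(w_1;w_2)-(\ell_1;\ell_2)\|}{\det(AA^T+I)^{1/(2n)}}.$$ (2) If $A$ has linearly independent rows, $m<n$, $w_1=\ell_1$, and $Q_N$ is computed using RKZ reduction and is nonempty, then $$\operatorname{width}(e_{n-m},Q_N)\le\frac{\gcd(A)\,\sqrt{n-m}\,\|w_2-\ell_2\|}{\det(AA^T)^{1/(2(n-m))}}.$$ (3) The same results hold when $Q_R$ and $Q_N$ are computed using LLL reduction, if $\sqrt{n}$ and $\sqrt{n-m}$ are replaced by $2^{(n-1)/4}$ and $2^{(n-m-1)/4}$, respectively.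
   Context: Norms are Euclidean, $I$ is an identity matrix, $e_j$ is the $j$th (last, for the dimensions used here) unit vector, and $(A;B)$ denotes the matrix (or vector) obtained by stacking $A$ on top of $B$. For an integral $m\times n$ matrix $A$ with independent rows, $\gcd(A)$ is the greatest common divisor of the $m\times m$ subdeterminants of $A$. For a polyhedron $P$ and an integral vector $z$, $\operatorname{width}(z,P)=\max\{\langle z,x\rangle : x\in P\}-\min\{\langle z,x\rangle : x\in P\}$. Lattices. A lattice is $L = \mathbb{L}(B) = \{Bx : x \in \mathbb{Z}^r\}$, with $B$ a real matrix with $r$ linearly independent columns $b_1,\dots,b_r$ (a basis of $L$). The Gram-Schmidt vectors are $b_1^* = b_1$ and $b_i^*$ = the projection of $b_i$ onto the orthogonal complement of the span of $b_1,\dots,b_{i-1}$; $\mu_{ij} = \langle b_i,b_j^*\rangle/\|b_j^*\|^2$ for $j<i$. LLL reduction. The basis is LLL-reduced if $|\mu_{ij}|\le \frac12$ for $1\le j<i\le r$ and $\|\mu_{i,i-1}b_{i-1}^*+b_i^*\|^2\ge\frac34\|b_{i-1}^*\|^2$ for $1<i\le r$. RKZ reduction. For $1\le k\le i\le r$ let $b_i(k) = b_i^* + \sum_{j=k}^{i-1}\mu_{ij}b_j^*$, and let $L_i$ be the lattice generated by $b_i(i), b_{i+1}(i),\dots,b_r(i)$. The basis is Korkhine-Zolotarev (KZ) reduced if $b_i(i)$ is a shortest nonzero vector of $L_i$ for every $i$. The reciprocal lattice of $L$ is $L' = \{z \in \operatorname{lin} L : \langle z,x\rangle \in \mathbb{Z}\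 \forall x\in L\}$ ($\operatorname{lin}$ is linear span); the reciprocal basis of $b_1,\dots,b_r$ is the basis $b_1',\dots,b_r'$ of $L'$ with $\langle b_i,b_j'\rangle = 1$ if $i+j=r+1$ and $0$ otherwise. The basis is reciprocal Korkhine-Zolotarev (RKZ) reduced if its reciprocal basis is a KZ reduced basis of $L'$. Reformulations of $Q=\{x\in\mathbb{R}^n : \ell_1\le Ax\le w_1,\ \ell_2\le x\le w_2\}$. $Q_R = \{y \in \mathbb{R}^n : (\ell_1;\ell_2) \le (A;I)Uy \le (w_1;w_2)\}$, where $U$ is a unimodular matrix such that the columns of $(A;I)U$ form a reduced basis of $\mathbb{L}((A;I))$. When $A$ has independent rows and $w_1=\ell_1$, $Q_N = \{y \in \mathbb{R}^{n-m} : \ell_2 - x_0 \le By \le w_2 - x_0\}$, where $x_0\in\mathbb{Z}^n$ satisfies $Ax_0=\ell_1$ (assumed to exist) and the columns of $B$ form a reduced basis of $\{x\in\mathbb{Z}^n : Ax=0\}$. "Computed using RKZ (respectively LLL) reduction" means that the reduced basis is RKZ reduced (respectively LLL-reduced). *)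

theory Defs
  imports
    "Jordan_Normal_Form.Gram_Schmidt"
    "Jordan_Normal_Form.Determinant"
    "Jordan_Normal_Form.DL_Submatrix"
    "HOL-Library.Extended_Real"
begin

text \<open>Matrices and vectors carry their dimensions as natural numbers. All indices start at 0,
  so the basis vectors \<open>b\<^sub>1, \<dots>, b\<^sub>r\<close> are the columns \<open>col B 0, \<dots>, col B (r - 1)\<close>, and
  \<open>e\<^sub>n\<close> is \<open>unit_vec n (n - 1)\<close>.\<close>

abbreviation real_vec :: "int vec \<Rightarrow> real vec" where
  "real_vec \<equiv> map_vec real_of_int"

abbreviation real_mat :: "int mat \<Rightarrow> real mat" where
  "real_mat \<equiv> map_mat real_of_int"

definition vnorm :: "real vec \<Rightarrow> real" where
  "vnorm v = sqrt (v \<bullet> v)"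

definition indep_cols :: "real mat \<Rightarrow> bool" where
  "indep_cols B \<longleftrightarrow>
     (\<forall>x \<in> carrier_vec (dim_col B). B *\<^sub>v x = 0\<^sub>v (dim_row B) \<longrightarrow> x = 0\<^sub>v (dim_col B))"

definition indep_rows :: "real mat \<Rightarrow> bool" where
  "indep_rows A \<longleftrightarrow> indep_cols (transpose_mat A)"

definition gcd_mat :: "int mat \<Rightarrow> int" where
  "gcd_mat A = Gcd {det (submatrix A UNIV J) | J. J \<subseteq> {..<dim_col A} \<and> card J = dim_row A}"

text \<open>The extended real value makes an unbounded direction visible: the width is then \<open>\<infinity>\<close>.
  On a nonempty polyhedron, a finite supremum or infimum of a linear form is attained, so that a
  finite width is the difference of a maximum and a minimum.\<close>

definition width :: "int vec \<Rightarrow> real vec set \<Rightarrow> ereal" where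
  "width z P = (SUP x\<in>P. ereal (real_vec z \<bullet> x)) - (INF x\<in>P. ereal (real_vec z \<bullet> x))"

definition lattice_of :: "real mat \<Rightarrow> real vec set" where
  "lattice_of B = {B *\<^sub>v real_vec x | x. x \<in> carrier_vec (dim_col B)}"

definition is_lattice_basis :: "real mat \<Rightarrow> real vec set \<Rightarrow> bool" where
  "is_lattice_basis B L \<longleftrightarrow> indep_cols B \<and> lattice_of B = L"

definition gs :: "real mat \<Rightarrow> nat \<Rightarrow> real vec" where
  "gs B i = gram_schmidt (dim_row B) (cols B) ! i"

definition gs_mu :: "real mat \<Rightarrow> nat \<Rightarrow> nat \<Rightarrow> real" where
  "gs_mu B i j = (col B i \<bullet> gs B j) / (vnorm (gs B j))\<^sup>2"

definition lll_reduced :: "real mat \<Rightarrow> bool" where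
  "lll_reduced B \<longleftrightarrow>
     (\<forall>i < dim_col B. \<forall>j < i. \<bar>gs_mu B i j\<bar> \<le> 1 / 2) \<and>
     (\<forall>i < dim_col B. 0 < i \<longrightarrow>
        (vnorm (gs_mu B i (i - 1) \<cdot>\<^sub>v gs B (i - 1) + gs B i))\<^sup>2
          \<ge> 3 / 4 * (vnorm (gs B (i - 1)))\<^sup>2)"

text \<open>\<open>proj_basis_vec B i k\<close> is the vector \<open>b\<^sub>i(k)\<close>, and \<open>proj_lattice B i\<close> is the lattice \<open>L\<^sub>i\<close>.\<close>

definition proj_basis_vec :: "real mat \<Rightarrow> nat \<Rightarrow> nat \<Rightarrow> real vec" where
  "proj_basis_vec B i k =
     gs B i + finsum_vec TYPE(real) (dim_row B) (\<lambda>j. gs_mu B i j \<cdot>\<^sub>v gs B j) {k..<i}"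

definition proj_lattice :: "real mat \<Rightarrow> nat \<Rightarrow> real vec set" where
  "proj_lattice B i =
     lattice_of (mat_of_cols (dim_row B) (map (\<lambda>j. proj_basis_vec B j i) [i..<dim_col B]))"

definition is_shortest_nonzero :: "real vec \<Rightarrow> real vec set \<Rightarrow> bool" where
  "is_shortest_nonzero v L \<longleftrightarrow>
     v \<in> L \<and> v \<noteq> 0\<^sub>v (dim_vec v) \<and>
     (\<forall>u \<in> L. u \<noteq> 0\<^sub>v (dim_vec u) \<longrightarrow> vnorm v \<le> vnorm u)"

definition kz_reduced :: "real mat \<Rightarrow> bool" where
  "kz_reduced B \<longleftrightarrow>
     (\<forall>i < dim_col B. is_shortest_nonzero (proj_basis_vec B i i) (proj_lattice B i))"

definition reciprocal_lattice :: "nat \<Rightarrow> real vec set \<Rightarrow> real vec set" where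
  "reciprocal_lattice n L =
     {z \<in> LinearCombinations.module.span class_ring (module_vec TYPE(real) n) L.
        \<forall>x \<in> L. z \<bullet> x \<in> \<int>}"

definition is_reciprocal_basis :: "real mat \<Rightarrow> real mat \<Rightarrow> bool" where
  "is_reciprocal_basis B B' \<longleftrightarrow>
     B' \<in> carrier_mat (dim_row B) (dim_col B) \<and>
     is_lattice_basis B' (reciprocal_lattice (dim_row B) (lattice_of B)) \<and>
     (\<forall>i < dim_col B. \<forall>j < dim_col B.
        col B i \<bullet> col B' j = (if i + j + 1 = dim_col B then 1 else 0))"

text \<open>The reciprocal basis of linearly independent columns exists and is unique, so the existential
  quantifier selects it.\<close>

definition rkz_reduced :: "real mat \<Rightarrow> bool" where
  "rkz_reduced B \<longleftrightarrow> (\<exists>B'. is_reciprocal_basis B B' \<and> kz_reduced B')"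

definition unimodular :: "int mat \<Rightarrow> bool" where
  "unimodular U \<longleftrightarrow> square_mat U \<and> \<bar>det U\<bar> = 1"

definition stack_id :: "int mat \<Rightarrow> int mat" where
  "stack_id A = A @\<^sub>r 1\<^sub>m (dim_col A)"

text \<open>The parameter \<open>red\<close> is the notion of reducedness, such as \<open>rkz_reduced\<close> or
  \<open>lll_reduced\<close>.\<close>

definition R_transform :: "(real mat \<Rightarrow> bool) \<Rightarrow> int mat \<Rightarrow> int mat \<Rightarrow> bool" where
  "R_transform red A U \<longleftrightarrow>
     U \<in> carrier_mat (dim_col A) (dim_col A) \<and> unimodular U \<and>
     is_lattice_basis (real_mat (stack_id A * U)) (lattice_of (real_mat (stack_id A))) \<and>
     red (real_mat (stack_id A * U))"

definition Q_R :: "int mat \<Rightarrow> int vec \<Rightarrow> int vec \<Rightarrow> int vec \<Rightarrow> int vec \<Rightarrow> int mat \<Rightarrow> real vec set" where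
  "Q_R A l1 w1 l2 w2 U =
     {y \<in> carrier_vec (dim_col A).
        real_vec (l1 @\<^sub>v l2) \<le> real_mat (stack_id A * U) *\<^sub>v y \<and>
        real_mat (stack_id A * U) *\<^sub>v y \<le> real_vec (w1 @\<^sub>v w2)}"

definition int_kernel :: "int mat \<Rightarrow> int vec set" where
  "int_kernel A = {x \<in> carrier_vec (dim_col A). A *\<^sub>v x = 0\<^sub>v (dim_row A)}"

definition N_transform :: "(real mat \<Rightarrow> bool) \<Rightarrow> int mat \<Rightarrow> int vec \<Rightarrow> real mat \<Rightarrow> int vec \<Rightarrow> bool" where
  "N_transform red A l1 B x0 \<longleftrightarrow>
     x0 \<in> carrier_vec (dim_col A) \<and> A *\<^sub>v x0 = l1 \<and>
     B \<in> carrier_mat (dim_col A) (dim_col A - dim_row A) \<and>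
     is_lattice_basis B (real_vec ` int_kernel A) \<and> red B"

definition Q_N :: "int vec \<Rightarrow> int vec \<Rightarrow> real mat \<Rightarrow> int vec \<Rightarrow> real vec set" where
  "Q_N l2 w2 B x0 =
     {y \<in> carrier_vec (dim_col B).
        real_vec (l2 - x0) \<le> B *\<^sub>v y \<and> B *\<^sub>v y \<le> real_vec (w2 - x0)}"

end

theory Submission
  imports Defs
    "Jordan_Normal_Form.Gauss_Jordan_Elimination"
    "HOL-Analysis.L2_Norm"
    "HOL-Library.FuncSet"
begin

text \<open>Let \<open>B\<close> be a reduced basis with \<open>r\<close> columns and Gram determinant \<open>D\<close>. For two points \<open>x, y\<close> of the
  polyhedron, \<open>B (x - y)\<close> is bounded entrywise by the side lengths of the box, so everything rests on
  the bound \<open>|z\<^sub>r| D\<^bsup>1/(2r)\<^esup> \<le> c\<^sub>r \<parallel>B z\<parallel>\<close>. For LLL reduction, \<open>|z\<^sub>r| \<parallel>b\<^sub>r\<^sup>*\<parallel> \<le> \<parallel>B z\<parallel>\<close> and the squared norms of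
  the Gram-Schmidt vectors, whose product is \<open>D\<close>, drop at most by a factor 2 at each index. For RKZ
  reduction, \<open>z\<^sub>r\<close> is the inner product of \<open>B z\<close> with the first reciprocal basis vector, which is a
  shortest vector of a lattice with Gram determinant \<open>1/D\<close> and is bounded by Minkowski's theorem.

  For \<open>Q\<^sub>R\<close>, \<open>D = det (A A\<^sup>T + I)\<close> by Sylvester's identity. For \<open>Q\<^sub>N\<close>, choose an integral \<open>X\<close> such that the
  columns of \<open>H = A X\<close> generate the same lattice as those of \<open>A\<close>. Then \<open>det H\<close> divides \<open>gcd A\<close>, and
  comparing determinants in \<open>(A; B\<^sup>T) (X, B) = (H, 0; B\<^sup>T X, B\<^sup>T B)\<close> gives \<open>det (A A\<^sup>T) \<le> (det H)\<^sup>2 D\<close>.\<close>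

section \<open>Minkowski's theorem on linear forms\<close>

text \<open>Back substitution from the last form: form \<open>j\<close> has coefficient 1 at
  \<open>x j\<close> and otherwise involves only larger indices, so once these are fixed the integer
  \<open>x j\<close> shifts the floor to any prescribed value.\<close>

lemma ex_int_floor_triangular:
  fixes t :: "nat \<Rightarrow> nat \<Rightarrow> real" and k :: "nat \<Rightarrow> int"
  shows "\<exists>x :: nat \<Rightarrow> int. \<forall>j<r. \<lfloor>x j + (\<Sum>i\<in>{j<..<r}. t j i * x i)\<rfloor> = k j"
proof -
  have "\<exists>x :: nat \<Rightarrow> int. \<forall>j<r. r \<le> j + s \<longrightarrow> \<lfloor>x j + (\<Sum>i\<in>{j<..<r}. t j i * x i)\<rfloor> = k j" for s
  proof (induction s)
    case 0
    then show ?case by auto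
  next
    case (Suc s)
    then obtain x :: "nat \<Rightarrow> int"
      where x: "\<And>j. j < r \<Longrightarrow> r \<le> j + s \<Longrightarrow> \<lfloor>x j + (\<Sum>i\<in>{j<..<r}. t j i * x i)\<rfloor> = k j"
      by blast
    \<comment> \<open>\<open>l\<close> is the next form to solve. Once \<open>s\<close> reaches
      \<open>r\<close>, truncated subtraction gives \<open>l = 0\<close>, and form 0 is merely
      solved again.\<close>
    define l where "l = r - Suc s"
    define x' where "x' = x(l := k l - \<lfloor>\<Sum>i\<in>{l<..<r}. t l i * x i\<rfloor>)"
    have "\<lfloor>x' j + (\<Sum>i\<in>{j<..<r}. t j i * x' i)\<rfloor> = k j" if j: "j < r" "r \<le> j + Suc s" for j
    proof -
      have "(\<Sum>i\<in>{j<..<r}. t j i * x' i) = (\<Sum>i\<in>{j<..<r}. t j i * x i)"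
        using j by (intro sum.cong) (auto simp: x'_def l_def)
      moreover have "j = l \<or> (j \<noteq> l \<and> r \<le> j + s)"
        using j by (auto simp: l_def)
      ultimately show ?thesis
        using x[of j] j by (auto simp: x'_def)
    qed
    then show ?case by blast
  qed
  from this[of r] show ?thesis by auto
qed

text \<open>No volumes are needed: taking floors of the forms is a surjection from the integer points to the
  integer points, so a box contains at least as many points of \<open>1/q\<close> times the integers as its side
  lengths predict, and two of them agree modulo the integers.\<close>

lemma triangular_linear_forms:
  fixes t :: "nat \<Rightarrow> nat \<Rightarrow> real" and d :: "nat \<Rightarrow> real"
  assumes d: "\<And>j. j < r \<Longrightarrow> 0 < d j" and c: "0 < c" "(\<Prod>j<r. d j) < c ^ r"
  shows "\<exists>z :: nat \<Rightarrow> int. (\<exists>j<r. z j \<noteq> (0 :: int)) \<and>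
           (\<forall>j<r. d j * \<bar>z j + (\<Sum>i\<in>{j<..<r}. t j i * z i)\<bar> < c)"
proof -
  define f where "f x j = real_of_int (x j) + (\<Sum>i\<in>{j<..<r}. t j i * real_of_int (x i))"
    for x :: "nat \<Rightarrow> int" and j
  have P: "0 < (\<Prod>j<r. d j)" using d by (intro prod_pos) auto
  have inv: "(\<lambda>q. 1 / real q) \<longlonglongrightarrow> 0"
    using lim_inverse_n by (simp add: inverse_eq_divide)
  \<comment> \<open>The hypothesis says that the box with sides \<open>c / d j\<close> has volume
    greater than 1. For large \<open>q\<close> this survives shortening each side by
    \<open>1 / q\<close>, which pays for rounding \<open>q * (c / d j)\<close> down to the integer
    \<open>N j\<close>.\<close>
  have "(\<lambda>q. \<Prod>j<r. c / d j - 1 / real q) \<longlonglongrightarrow> (\<Prod>j<r. c / d j - 0)"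
    by (intro tendsto_intros inv)
  moreover have "1 < (\<Prod>j<r. c / d j - 0)"
    using c P by (simp add: prod_dividef)
  ultimately have "eventually (\<lambda>q. 1 < (\<Prod>j<r. c / d j - 1 / real q)) sequentially"
    by (rule order_tendstoD(1))
  moreover have "eventually (\<lambda>q. \<forall>j\<in>{..<r}. 1 / real q < c / d j) sequentially"
    using c d by (intro eventually_ball_finite ballI order_tendstoD(2)[OF inv]) auto
  moreover have "eventually (\<lambda>q. 0 < q) sequentially" by (rule eventually_gt_at_top)
  ultimately have "eventually (\<lambda>q. 1 < (\<Prod>j<r. c / d j - 1 / real q) \<and>
      (\<forall>j\<in>{..<r}. 1 / real q < c / d j) \<and> 0 < q) sequentially"
    by eventually_elim simp
  then obtain q where q1: "1 < (\<Prod>j<r. c / d j - 1 / real q)"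
    and q2: "\<And>j. j < r \<Longrightarrow> 1 / real q < c / d j" and q0: "0 < q"
    by (auto dest!: eventually_happens)
  define N where "N j = nat \<lfloor>real q * (c / d j)\<rfloor>" for j
  have N_le: "real (N j) \<le> real q * (c / d j)" if "j < r" for j
    unfolding N_def using c d[OF that] q0 by simp
  have "real q ^ r < real q ^ r * (\<Prod>j<r. c / d j - 1 / real q)"
    using q0 q1 by simp
  also have "\<dots> = (\<Prod>j<r. real q * (c / d j - 1 / real q))"
    by (simp add: prod.distrib)
  also have "\<dots> \<le> (\<Prod>j<r. real (N j))"
  proof (intro prod_mono conjI)
    fix j assume j: "j \<in> {..<r}"
    show "0 \<le> real q * (c / d j - 1 / real q)" using q2[of j] j by simp
    have "real q * (c / d j - 1 / real q) = real q * (c / d j) - 1"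
      using q0 by (simp add: algebra_simps)
    also have "\<dots> \<le> real (N j)" unfolding N_def by linarith
    finally show "real q * (c / d j - 1 / real q) \<le> real (N j)" .
  qed
  finally have big: "q ^ r < (\<Prod>j<r. N j)"
    by (simp flip: of_nat_power of_nat_prod)
  obtain x where x: "\<And>k j. j < r \<Longrightarrow> \<lfloor>f (x k) j\<rfloor> = k j"
    using ex_int_floor_triangular[of r t] unfolding f_def by metis
  define K where "K = Pi\<^sub>E {..<r} (\<lambda>j. {0..<int (N j)})"
  \<comment> \<open>\<open>\<rho> k\<close> is the residue class modulo \<open>q\<close> of the
    integer point whose forms have floors \<open>k\<close>. There are \<open>q ^ r\<close> classes,
    fewer than there are points in \<open>K\<close>.\<close>
  define \<rho> where "\<rho> k = restrict (\<lambda>j. x k j mod int q) {..<r}" for k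
  have "\<rho> ` K \<subseteq> Pi\<^sub>E {..<r} (\<lambda>_. {0..<int q})"
    using q0 unfolding \<rho>_def by (intro image_subsetI restrict_PiE_iff[THEN iffD2]) simp
  moreover have "card (Pi\<^sub>E {..<r} (\<lambda>_. {0..<int q})) < card K"
    using big by (simp add: K_def card_PiE)
  moreover have "finite (Pi\<^sub>E {..<r} (\<lambda>_. {0..<int q}))" by (intro finite_PiE) auto
  ultimately have "\<not> inj_on \<rho> K"
    by (meson card_inj_on_le leD)
  then obtain k k' where k: "k \<in> K" "k' \<in> K" "\<rho> k = \<rho> k'" "k \<noteq> k'"
    by (auto simp: inj_on_def)
  define z where "z j = (x k j - x k' j) div int q" for j
  have qz: "int q * z j = x k j - x k' j" if "j < r" for j
  proof -
    have "x k j mod int q = x k' j mod int q"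
      using fun_cong[OF k(3), of j] that by (simp add: \<rho>_def)
    then show ?thesis
      unfolding z_def by (simp add: mod_eq_dvd_iff)
  qed
  have fz: "real q * f z j = f (x k) j - f (x k') j" if "j < r" for j
  proof -
    have qz': "real q * z i = real_of_int (x k i) - x k' i" if "i < r" for i
      using arg_cong[OF qz[OF that], of real_of_int] by simp
    have "real q * f z j = real q * z j + (\<Sum>i\<in>{j<..<r}. t j i * (real q * z i))"
      by (simp add: f_def sum_distrib_left algebra_simps)
    also have "(\<Sum>i\<in>{j<..<r}. t j i * (real q * z i)) = (\<Sum>i\<in>{j<..<r}. t j i * (real_of_int (x k i) - x k' i))"
      using qz' by (intro sum.cong) auto
    finally show ?thesis
      using qz'[OF that] by (simp add: f_def algebra_simps sum_subtractf)
  qed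
  \<comment> \<open>If \<open>z\<close> vanished, the forms would agree at \<open>x k\<close> and
    \<open>x k'\<close>, and so would their floors \<open>k\<close> and \<open>k'\<close>.\<close>
  have "\<exists>j<r. z j \<noteq> 0"
  proof (rule ccontr)
    assume "\<not> (\<exists>j<r. z j \<noteq> (0 :: int))"
    hence "f (x k) j = f (x k') j" if "j < r" for j
      using fz[OF that] that by (simp add: f_def)
    hence "k j = k' j" if "j < r" for j
      using x[OF that] that by metis
    hence "k = k'" using k(1,2) unfolding K_def by (intro PiE_ext) auto
    thus False using k(4) by simp
  qed
  \<comment> \<open>Up to the factor \<open>1 / q\<close>, \<open>f z j\<close> is the difference of
    two values whose floors lie in \<open>{0..<N j}\<close>, and \<open>N j\<close> is at most
    \<open>q * (c / d j)\<close>.\<close>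
  moreover have "d j * \<bar>f z j\<bar> < c" if j: "j < r" for j
  proof -
    have bd: "0 \<le> f (x \<kappa>) j" "f (x \<kappa>) j < real (N j)" if "\<kappa> \<in> K" for \<kappa>
    proof -
      have "\<kappa> j \<in> {0..<int (N j)}"
        using PiE_mem[of \<kappa> "{..<r}" "\<lambda>j. {0..<int (N j)}" j] that j unfolding K_def by simp
      hence "real_of_int 0 \<le> real_of_int (\<kappa> j)" "real_of_int (\<kappa> j + 1) \<le> real_of_int (int (N j))"
        unfolding of_int_le_iff by auto
      moreover have "real_of_int (\<kappa> j) \<le> f (x \<kappa>) j" "f (x \<kappa>) j < real_of_int (\<kappa> j) + 1"
        using x[OF j, of \<kappa>] floor_eq_iff by blast+
      ultimately show "0 \<le> f (x \<kappa>) j" "f (x \<kappa>) j < real (N j)" by simp_all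
    qed
    hence "\<bar>f (x k) j - f (x k') j\<bar> < real (N j)"
      using bd[OF k(1)] bd[OF k(2)] by linarith
    hence "real q * \<bar>f z j\<bar> < real q * (c / d j)"
      using N_le[OF j] fz[OF j] by (metis abs_mult abs_of_nat order_less_le_trans)
    hence "\<bar>f z j\<bar> < c / d j"
      using q0 by (simp only: mult_less_cancel_left_pos of_nat_0_less_iff)
    thus ?thesis using d[OF j] by (simp add: pos_less_divide_eq mult.commute)
  qed
  ultimately show ?thesis unfolding f_def by blast
qed

section \<open>Gram-Schmidt orthogonalization\<close>

lemma conjugate_real_vec [simp]: "conjugate (v :: real vec) = v"
  by (intro eq_vecI) auto

lemma scalar_prod_self_ge_0: "0 \<le> (v :: real vec) \<bullet> v"
  by (simp add: scalar_prod_def sum_nonneg)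

lemma scalar_prod_self_eq_0_iff:
  "v \<in> carrier_vec n \<Longrightarrow> (v :: real vec) \<bullet> v = 0 \<longleftrightarrow> v = 0\<^sub>v n"
  using conjugate_square_eq_0_vec[of v n] by simp

lemma vnorm_ge_0: "0 \<le> vnorm v"
  by (simp add: vnorm_def scalar_prod_self_ge_0)

lemma vnorm_power2: "(vnorm v)\<^sup>2 = v \<bullet> v"
  by (simp add: vnorm_def scalar_prod_self_ge_0)

lemma Cauchy_Schwarz_vnorm:
  assumes "v \<in> carrier_vec n" "w \<in> carrier_vec n"
  shows "\<bar>v \<bullet> w\<bar> \<le> vnorm v * vnorm w"
proof -
  have "\<bar>v \<bullet> w\<bar> \<le> (\<Sum>i\<in>{0..<n}. \<bar>v $ i\<bar> * \<bar>w $ i\<bar>)"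
    using assms sum_abs[of "\<lambda>i. v $ i * w $ i" "{0..<n}"] by (simp add: scalar_prod_def abs_mult)
  also have "\<dots> \<le> L2_set (($) v) {0..<n} * L2_set (($) w) {0..<n}"
    by (rule L2_set_mult_ineq)
  also have "\<dots> = vnorm v * vnorm w"
    using assms by (simp add: L2_set_def vnorm_def scalar_prod_def power2_eq_square)
  finally show ?thesis .
qed

section \<open>From the Gram-Schmidt recursion to orthogonality\<close>

lemma length_gram_schmidt_sub2 [simp]: "length (gram_schmidt_sub2 n us ws) = length ws"
  by (induction ws arbitrary: us) (auto simp: Let_def)

text \<open>The recursion puts each new vector in front of its accumulator \<open>us\<close>, hence
  the \<open>rev\<close>.\<close>

lemma nth_gram_schmidt_sub2:
  "i < length ws \<Longrightarrow> gram_schmidt_sub2 n us ws ! i =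
     adjuster n (ws ! i) (rev (take i (gram_schmidt_sub2 n us ws)) @ us) + ws ! i"
  by (induction ws arbitrary: i us) (auto simp: Let_def nth_Cons take_Cons split: nat.splits)

lemma adjuster_carrier:
  "set us \<subseteq> carrier_vec n \<Longrightarrow> adjuster n w us \<in> carrier_vec n"
  by (induction us) auto

lemma index_adjuster:
  "set us \<subseteq> carrier_vec n \<Longrightarrow> k < n \<Longrightarrow>
     adjuster n w us $ k = (\<Sum>u\<leftarrow>us. - (w \<bullet>c u) / (u \<bullet>c u) * u $ k)"
proof (induction us)
  case (Cons u us)
  then show ?case using adjuster_carrier[of us n w] by auto
qed simp

lemma gs_eq_adjuster:
  assumes "i < dim_col B"
  shows "gs B i = adjuster (dim_row B) (col B i) (rev (map (gs B) [0..<i])) + col B i"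
proof -
  have "take i (gram_schmidt (dim_row B) (cols B)) = map (gs B) [0..<i]"
    using assms by (intro nth_equalityI) (auto simp: gs_def gram_schmidt_code)
  thus ?thesis
    using nth_gram_schmidt_sub2[of i "cols B" "dim_row B" "[]"] assms
    by (simp add: gs_def gram_schmidt_code)
qed

lemma gs_carrier: "i < dim_col B \<Longrightarrow> gs B i \<in> carrier_vec (dim_row B)"
proof (induction i rule: less_induct)
  case (less i)
  have "adjuster (dim_row B) (col B i) (rev (map (gs B) [0..<i])) \<in> carrier_vec (dim_row B)"
    using less by (intro adjuster_carrier) auto
  then show ?case
    using less.prems by (subst gs_eq_adjuster) auto
qed

text \<open>The recursion solved for the original column, coordinate by coordinate. Division by zero
  yields 0 in the adjuster and in \<open>gs_mu\<close> alike, so zero Gram-Schmidt vectors do no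
  harm.\<close>

lemma gs_decomp:
  assumes i: "i < dim_col B" and k: "k < dim_row B"
  shows "col B i $ k = gs B i $ k + (\<Sum>j<i. gs_mu B i j * gs B j $ k)"
proof -
  let ?us = "rev (map (gs B) [0..<i])"
  have us: "set ?us \<subseteq> carrier_vec (dim_row B)"
    using i by (auto intro!: gs_carrier)
  have "adjuster (dim_row B) (col B i) ?us $ k =
      (\<Sum>u\<leftarrow>?us. - (col B i \<bullet> u) / (u \<bullet> u) * u $ k)"
    using index_adjuster[OF us k] by simp
  also have "\<dots> = (\<Sum>j\<leftarrow>[0..<i]. - (col B i \<bullet> gs B j) / (gs B j \<bullet> gs B j) * gs B j $ k)"
    by (simp add: rev_map[symmetric] sum_list_rev o_def del: upt_Suc)
  also have "\<dots> = (\<Sum>j<i. - (gs_mu B i j * gs B j $ k))"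
    by (simp add: interv_sum_list_conv_sum_set_nat atLeast0LessThan gs_mu_def vnorm_power2)
  finally show ?thesis
    using gs_eq_adjuster[OF i] adjuster_carrier[OF us, of "col B i"] k by (simp add: sum_negf)
qed

text \<open>Strong induction: in the product of \<open>gs B j\<close> with the decomposition of
  \<open>col B i\<close>, the earlier vectors are already orthogonal to each other, so only
  \<open>gs B i \<bullet> gs B j\<close> and the term with \<open>gs_mu B i j\<close> survive. The
  latter alone equals \<open>col B i \<bullet> gs B j\<close>.\<close>

lemma gs_orthogonal:
  "j < i \<Longrightarrow> i < dim_col B \<Longrightarrow> gs B i \<bullet> gs B j = 0"
proof (induction i arbitrary: j rule: less_induct)
  case (less i)
  let ?n = "dim_row B"
  have C: "gs B l \<in> carrier_vec ?n" if "l \<le> i" for l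
    using less.prems that by (intro gs_carrier) auto
  have orth: "gs B l \<bullet> gs B j = (if l = j then gs B j \<bullet> gs B j else 0)" if "l < i" for l
    using less.IH[of l j] less.IH[of j l] that less.prems C comm_scalar_prod[of "gs B l" ?n "gs B j"]
    by (cases l j rule: linorder_cases) auto
  have "col B i \<bullet> gs B j = (\<Sum>k\<in>{0..<?n}. (gs B i $ k + (\<Sum>l<i. gs_mu B i l * gs B l $ k)) * gs B j $ k)"
  proof -
    have "dim_vec (gs B j) = ?n" using C[of j] less.prems(1) by auto
    thus ?thesis
      unfolding scalar_prod_def
      by (intro sum.cong) (simp_all only: atLeastLessThan_iff gs_decomp[OF less.prems(2)])
  qed
  also have "\<dots> = gs B i \<bullet> gs B j + (\<Sum>k\<in>{0..<?n}. \<Sum>l<i. gs_mu B i l * (gs B l $ k * gs B j $ k))"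
    using C[of j] less.prems
    by (simp add: scalar_prod_def distrib_right sum.distrib sum_distrib_right mult.assoc)
  also have "(\<Sum>k\<in>{0..<?n}. \<Sum>l<i. gs_mu B i l * (gs B l $ k * gs B j $ k)) =
      (\<Sum>l<i. gs_mu B i l * (gs B l \<bullet> gs B j))"
    using C[of j] less.prems
    by (subst sum.swap) (simp add: scalar_prod_def sum_distrib_left)
  also have "\<dots> = (\<Sum>l<i. if l = j then gs_mu B i j * (gs B j \<bullet> gs B j) else 0)"
    by (intro sum.cong refl, subst orth) auto
  also have "\<dots> = gs_mu B i j * (gs B j \<bullet> gs B j)"
    using less.prems by simp
  \<comment> \<open>If \<open>gs B j\<close> is the zero vector, the quotient in
    \<open>gs_mu\<close> is 0 by convention and both sides vanish.\<close>
  also have "\<dots> = col B i \<bullet> gs B j"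
    using scalar_prod_self_eq_0_iff[OF C[of j]] less.prems col_dim[of B i]
    by (cases "gs B j \<bullet> gs B j = 0") (auto simp: gs_mu_def vnorm_power2)
  finally show ?case by simp
qed

section \<open>Orthogonal-triangular factorization and the Gram determinant\<close>

definition gs_mat :: "real mat \<Rightarrow> real mat" where
  "gs_mat B = mat (dim_row B) (dim_col B) (\<lambda>(k, j). gs B j $ k)"

definition gs_coeff_mat :: "real mat \<Rightarrow> real mat" where
  "gs_coeff_mat B = mat (dim_col B) (dim_col B)
     (\<lambda>(j, i). if j < i then gs_mu B i j else if j = i then 1 else 0)"

lemma gs_mat_carrier [simp]: "gs_mat B \<in> carrier_mat (dim_row B) (dim_col B)"
  and gs_coeff_mat_carrier [simp]: "gs_coeff_mat B \<in> carrier_mat (dim_col B) (dim_col B)"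
  by (auto simp: gs_mat_def gs_coeff_mat_def)

lemma col_gs_mat: "j < dim_col B \<Longrightarrow> col (gs_mat B) j = gs B j"
  using gs_carrier[of j B] by (intro eq_vecI) (auto simp: gs_mat_def)

text \<open>A QR decomposition without normalization: the first factor has orthogonal columns, and
  the second is unit upper triangular because \<open>gs_mu B i j\<close> sits in row
  \<open>j\<close> and column \<open>i\<close>.\<close>

lemma gs_factorization: "B = gs_mat B * gs_coeff_mat B"
proof (rule eq_matI)
  fix k i assume "k < dim_row (gs_mat B * gs_coeff_mat B)" "i < dim_col (gs_mat B * gs_coeff_mat B)"
  hence k: "k < dim_row B" and i: "i < dim_col B" by (auto simp: gs_mat_def gs_coeff_mat_def)
  have "(gs_mat B * gs_coeff_mat B) $$ (k, i) =
      (\<Sum>j\<in>{0..<dim_col B}. gs B j $ k * (if j < i then gs_mu B i j else if j = i then 1 else 0))"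
    using k i by (simp add: scalar_prod_def gs_mat_def gs_coeff_mat_def)
  also have "\<dots> = (\<Sum>j\<in>{0..<dim_col B}. (if j < i then gs_mu B i j * gs B j $ k else 0)
      + (if j = i then gs B j $ k else 0))"
    by (intro sum.cong) auto
  also have "\<dots> = (\<Sum>j\<in>{0..<dim_col B} \<inter> {j. j < i}. gs_mu B i j * gs B j $ k) + gs B i $ k"
    using i by (simp add: sum.distrib sum.inter_restrict)
  also have "{0..<dim_col B} \<inter> {j. j < i} = {..<i}" using i by auto
  finally show "B $$ (k, i) = (gs_mat B * gs_coeff_mat B) $$ (k, i)"
    using gs_decomp[OF i k] i k by simp
qed (auto simp: gs_mat_def gs_coeff_mat_def)

lemma gs_mat_gram:
  "transpose_mat (gs_mat B) * gs_mat B =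
     mat (dim_col B) (dim_col B) (\<lambda>(i, j). if i = j then gs B j \<bullet> gs B j else 0)"
proof (rule eq_matI)
  fix i j assume "i < dim_row (mat (dim_col B) (dim_col B) (\<lambda>(i, j). if i = j then gs B j \<bullet> gs B j else 0))"
    "j < dim_col (mat (dim_col B) (dim_col B) (\<lambda>(i, j). if i = j then gs B j \<bullet> gs B j else 0))"
  hence ij: "i < dim_col B" "j < dim_col B" by auto
  have "gs B i \<bullet> gs B j = (if i = j then gs B j \<bullet> gs B j else 0)"
    using gs_orthogonal[of i j B] gs_orthogonal[of j i B] ij
      comm_scalar_prod[OF gs_carrier[OF ij(1)] gs_carrier[OF ij(2)]]
    by (cases i j rule: linorder_cases) auto
  thus "(transpose_mat (gs_mat B) * gs_mat B) $$ (i, j) =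
      mat (dim_col B) (dim_col B) (\<lambda>(i, j). if i = j then gs B j \<bullet> gs B j else 0) $$ (i, j)"
    using ij by (auto simp: col_gs_mat gs_mat_def[THEN arg_cong[of _ _ dim_col]])
qed (auto simp: gs_mat_def)

lemma det_gs_coeff_mat: "det (gs_coeff_mat B) = 1"
proof -
  have "upper_triangular (gs_coeff_mat B)"
    by (simp add: upper_triangular_def gs_coeff_mat_def)
  moreover have "prod_list (diag_mat (gs_coeff_mat B)) = 1"
    unfolding prod_list_diag_prod by (rule prod.neutral) (simp add: gs_coeff_mat_def)
  ultimately show ?thesis
    by (simp add: det_upper_triangular[OF _ gs_coeff_mat_carrier])
qed

text \<open>The triangular factor has determinant 1, so only the diagonal Gram matrix of the
  orthogonal factor contributes.\<close>

lemma det_gram: "det (transpose_mat B * B) = (\<Prod>j<dim_col B. gs B j \<bullet> gs B j)"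
proof -
  let ?r = "dim_col B" and ?S = "gs_mat B" and ?T = "gs_coeff_mat B"
  let ?D = "mat ?r ?r (\<lambda>(i, j). if i = j then gs B j \<bullet> gs B j else 0)"
  have S: "?S \<in> carrier_mat (dim_row B) ?r" and T: "?T \<in> carrier_mat ?r ?r"
    by simp_all
  from S T have St: "transpose_mat ?S \<in> carrier_mat ?r (dim_row B)" and Tt: "transpose_mat ?T \<in> carrier_mat ?r ?r"
    by auto
  have "transpose_mat B * B = transpose_mat (?S * ?T) * (?S * ?T)"
    by (simp flip: gs_factorization)
  also have "\<dots> = transpose_mat ?T * transpose_mat ?S * (?S * ?T)"
    by (simp only: transpose_mult[OF S T])
  also have "\<dots> = transpose_mat ?T * (transpose_mat ?S * ?S) * ?T"
    by (simp only: assoc_mult_mat[OF Tt St mult_carrier_mat[OF S T]] assoc_mult_mat[OF Tt mult_carrier_mat[OF St S] T]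
        assoc_mult_mat[OF St S T])
  finally have *: "transpose_mat B * B = transpose_mat ?T * ?D * ?T"
    by (simp add: gs_mat_gram)
  have "det (transpose_mat B * B) = det ?D"
    unfolding * by (simp add: det_mult[OF mult_carrier_mat[OF Tt] T] det_mult[OF Tt] det_transpose[OF T]
        det_gs_coeff_mat)
  also have "\<dots> = (\<Prod>j<?r. gs B j \<bullet> gs B j)"
    by (subst det_upper_triangular[of _ ?r])
      (auto simp: upper_triangular_def prod_list_diag_prod atLeast0LessThan)
  finally show ?thesis .
qed

text \<open>The triangular factor sends \<open>y\<close> to the vector \<open>z\<close> of linear
  forms, and the orthogonal factor turns the squared norm into a diagonal quadratic form in
  \<open>z\<close>. These are the triangular forms to which Minkowski's theorem will be
  applied.\<close>

lemma norm_mult_mat_vec: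
  assumes y: "y \<in> carrier_vec (dim_col B)"
  shows "(vnorm (B *\<^sub>v y))\<^sup>2 =
    (\<Sum>j<dim_col B. gs B j \<bullet> gs B j * (y $ j + (\<Sum>i\<in>{j<..<dim_col B}. gs_mu B i j * y $ i))\<^sup>2)"
proof -
  let ?r = "dim_col B" and ?S = "gs_mat B" and ?T = "gs_coeff_mat B"
  let ?D = "mat ?r ?r (\<lambda>(i, j). if i = j then gs B j \<bullet> gs B j else 0)"
  define z where "z = ?T *\<^sub>v y"
  have S: "?S \<in> carrier_mat (dim_row B) ?r" and T: "?T \<in> carrier_mat ?r ?r"
    by simp_all
  have z: "z \<in> carrier_vec ?r" unfolding z_def using T y by (rule mult_mat_vec_carrier)
  have zj: "z $ j = y $ j + (\<Sum>i\<in>{j<..<?r}. gs_mu B i j * y $ i)" if j: "j < ?r" for j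
  proof -
    have "z $ j = (\<Sum>i\<in>{0..<?r}. (if j < i then gs_mu B i j else if j = i then 1 else 0) * y $ i)"
      using j y by (simp add: z_def scalar_prod_def gs_coeff_mat_def)
    also have "\<dots> = (\<Sum>i\<in>{0..<?r}. (if j < i then gs_mu B i j * y $ i else 0) + (if j = i then y $ i else 0))"
      by (intro sum.cong) auto
    also have "\<dots> = (\<Sum>i\<in>{0..<?r} \<inter> {i. j < i}. gs_mu B i j * y $ i) + y $ j"
      using j by (simp add: sum.distrib sum.inter_restrict)
    also have "{0..<?r} \<inter> {i. j < i} = {j<..<?r}" by auto
    finally show ?thesis by simp
  qed
  have "B *\<^sub>v y = ?S *\<^sub>v z"
    unfolding z_def using S T y by (subst gs_factorization) (rule assoc_mult_mat_vec)
  hence "(vnorm (B *\<^sub>v y))\<^sup>2 = (?S *\<^sub>v z) \<bullet> (?S *\<^sub>v z)"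
    by (simp add: vnorm_power2)
  also have "\<dots> = z \<bullet> (transpose_mat ?S *\<^sub>v (?S *\<^sub>v z))"
    using transpose_vec_mult_scalar[OF S z mult_mat_vec_carrier[OF S z]]
      comm_scalar_prod[OF z mult_mat_vec_carrier[OF _ mult_mat_vec_carrier[OF S z]], of "transpose_mat ?S"] S
    by simp
  also have "transpose_mat ?S *\<^sub>v (?S *\<^sub>v z) = ?D *\<^sub>v z"
    using assoc_mult_mat_vec[OF _ S z, of "transpose_mat ?S" ?r] by (simp add: gs_mat_gram)
  also have "z \<bullet> (?D *\<^sub>v z) = (\<Sum>j<?r. gs B j \<bullet> gs B j * (z $ j)\<^sup>2)"
  proof -
    have "(?D *\<^sub>v z) $ j = (gs B j \<bullet> gs B j) * z $ j" if "j < ?r" for j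
    proof -
      have "(?D *\<^sub>v z) $ j = (\<Sum>i\<in>{0..<?r}. (if j = i then gs B i \<bullet> gs B i else 0) * z $ i)"
        using that z by (simp add: scalar_prod_def)
      also have "\<dots> = (\<Sum>i\<in>{0..<?r}. if j = i then gs B i \<bullet> gs B i * z $ i else 0)"
        by (intro sum.cong) auto
      finally show ?thesis using that by simp
    qed
    thus ?thesis
      by (simp add: scalar_prod_def[of z] atLeast0LessThan power2_eq_square algebra_simps)
  qed
  also have "\<dots> = (\<Sum>j<?r. gs B j \<bullet> gs B j * (y $ j + (\<Sum>i\<in>{j<..<?r}. gs_mu B i j * y $ i))\<^sup>2)"
    by (intro sum.cong) (auto simp: zj)
  finally show ?thesis .
qed

text \<open>The Gram matrix has the same kernel as \<open>B\<close>, since pairing its value at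
  \<open>v\<close> with \<open>v\<close> gives the squared norm of \<open>B *\<^sub>v v\<close>. The
  sign comes from the product formula \<open>det_gram\<close>.\<close>

lemma det_gram_pos:
  assumes "indep_cols B"
  shows "0 < det (transpose_mat B * B)"
proof -
  have BtB: "transpose_mat B * B \<in> carrier_mat (dim_col B) (dim_col B)" by auto
  have "det (transpose_mat B * B) \<noteq> 0"
  proof
    assume "det (transpose_mat B * B) = 0"
    then obtain v where v: "v \<in> carrier_vec (dim_col B)" "v \<noteq> 0\<^sub>v (dim_col B)"
      and eq: "(transpose_mat B * B) *\<^sub>v v = 0\<^sub>v (dim_col B)"
      using det_0_iff_vec_prod_zero[OF BtB] by auto
    have Bv: "B *\<^sub>v v \<in> carrier_vec (dim_row B)" by (rule carrier_vecI) simp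
    have "(B *\<^sub>v v) \<bullet> (B *\<^sub>v v) = (transpose_mat B *\<^sub>v (B *\<^sub>v v)) \<bullet> v"
      using v Bv by (subst transpose_vec_mult_scalar) auto
    also have "transpose_mat B *\<^sub>v (B *\<^sub>v v) = 0\<^sub>v (dim_col B)"
      using v eq by (subst (asm) assoc_mult_mat_vec) auto
    finally have "B *\<^sub>v v = 0\<^sub>v (dim_row B)"
      using scalar_prod_self_eq_0_iff[OF Bv] v by simp
    thus False using assms v unfolding indep_cols_def by blast
  qed
  moreover have "0 \<le> det (transpose_mat B * B)"
    unfolding det_gram by (intro prod_nonneg) (auto simp: scalar_prod_self_ge_0)
  ultimately show ?thesis by simp
qed

lemma gs_self_pos:
  assumes "indep_cols B" "j < dim_col B"
  shows "0 < gs B j \<bullet> gs B j"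
proof -
  have "gs B j \<bullet> gs B j \<noteq> 0"
  proof
    assume "gs B j \<bullet> gs B j = 0"
    hence "det (transpose_mat B * B) = 0"
      unfolding det_gram using assms(2) by (intro prod_zero) auto
    thus False using det_gram_pos[OF assms(1)] by simp
  qed
  thus ?thesis using scalar_prod_self_ge_0[of "gs B j"] by simp
qed

section \<open>Reduced bases\<close>

lemma mult_unit_vec:
  fixes M :: "'a :: semiring_1 mat"
  assumes "j < dim_col M"
  shows "M *\<^sub>v unit_vec (dim_col M) j = col M j"
  using assms by (intro eq_vecI) auto

text \<open>Minkowski's bound on a shortest vector. The forms in \<open>norm_mult_mat_vec\<close>,
  weighted by the Gram-Schmidt norms \<open>d j\<close>, can all be made small at a nonzero integer
  point; the product of the weights is the square root of the Gram determinant, and adding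
  \<open>dim_col B\<close> squares costs the factor \<open>sqrt (dim_col B)\<close>.\<close>

lemma le_sqrt_dim_mult_det_gram:
  assumes B: "indep_cols B" and r: "0 < dim_col B"
    and min: "\<And>x. x \<in> carrier_vec (dim_col B) \<Longrightarrow> x \<noteq> 0\<^sub>v (dim_col B) \<Longrightarrow>
                 b \<le> vnorm (B *\<^sub>v real_vec x)"
  shows "b \<le> sqrt (real (dim_col B)) *
               det (transpose_mat B * B) powr (1 / (2 * real (dim_col B)))"
proof -
  let ?r = "dim_col B" and ?D = "det (transpose_mat B * B)"
  define d where "d j = sqrt (gs B j \<bullet> gs B j)" for j
  have d: "0 < d j" "(d j)\<^sup>2 = gs B j \<bullet> gs B j" if "j < ?r" for j
    using gs_self_pos[OF B that] by (simp_all add: d_def)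
  have D: "0 < ?D" by (rule det_gram_pos[OF B])
  define \<delta> where "\<delta> = ?D powr (1 / (2 * real ?r))"
  have \<delta>: "0 < \<delta>" unfolding \<delta>_def using D by simp
  have "\<delta> ^ ?r = ?D powr (real ?r * (1 / (2 * real ?r)))"
    unfolding \<delta>_def by (subst powr_realpow[symmetric]) (use D in \<open>auto simp: powr_powr mult.commute\<close>)
  also have "\<dots> = sqrt ?D"
    using r D by (simp add: powr_half_sqrt)
  also have "\<dots> = (\<Prod>j<?r. d j)"
  proof (rule real_sqrt_unique)
    show "(\<Prod>j<?r. d j)\<^sup>2 = ?D"
      unfolding det_gram prod_power_distrib by (intro prod.cong) (auto simp: d(2))
    show "0 \<le> (\<Prod>j<?r. d j)" by (intro prod_nonneg) (auto intro: less_imp_le d(1))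
  qed
  finally have prod_d: "(\<Prod>j<?r. d j) = \<delta> ^ ?r" by simp
  \<comment> \<open>The theorem on linear forms needs a strict inequality, so the bound is proved
    for every \<open>c\<close> above \<open>\<delta>\<close> and then passed to the limit.\<close>
  have "b \<le> sqrt (real ?r) * c" if c: "\<delta> < c" for c
  proof -
    have "(\<Prod>j<?r. d j) < c ^ ?r"
      unfolding prod_d using c \<delta> r by (intro power_strict_mono) auto
    then obtain z :: "nat \<Rightarrow> int" where z0: "\<exists>j<?r. z j \<noteq> 0"
      and z: "\<And>j. j < ?r \<Longrightarrow> d j * \<bar>z j + (\<Sum>i\<in>{j<..<?r}. gs_mu B i j * z i)\<bar> < c"
      using triangular_linear_forms[of ?r d c "\<lambda>j i. gs_mu B i j"] d(1) c \<delta> by auto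
    define x where "x = vec ?r z"
    have x: "x \<in> carrier_vec ?r" "x \<noteq> 0\<^sub>v ?r"
      using z0 by (auto simp: x_def vec_eq_iff)
    have "(vnorm (B *\<^sub>v real_vec x))\<^sup>2 =
        (\<Sum>j<?r. gs B j \<bullet> gs B j * (z j + (\<Sum>i\<in>{j<..<?r}. gs_mu B i j * z i))\<^sup>2)"
      using x(1) by (subst norm_mult_mat_vec) (auto simp: x_def)
    also have "\<dots> \<le> (\<Sum>j<?r. c\<^sup>2)"
    proof (rule sum_mono)
      fix j assume "j \<in> {..<?r}"
      hence j: "j < ?r" by simp
      let ?t = "z j + (\<Sum>i\<in>{j<..<?r}. gs_mu B i j * z i)"
      have "gs B j \<bullet> gs B j * ?t\<^sup>2 = (d j * \<bar>?t\<bar>)\<^sup>2"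
        using d(2)[OF j] by (simp add: power_mult_distrib)
      also have "\<dots> \<le> c\<^sup>2"
        using z[OF j] d(1)[OF j] by (intro power_mono) auto
      finally show "gs B j \<bullet> gs B j * ?t\<^sup>2 \<le> c\<^sup>2" .
    qed
    also have "\<dots> = (sqrt (real ?r) * c)\<^sup>2"
      by (simp add: power_mult_distrib)
    finally have "vnorm (B *\<^sub>v real_vec x) \<le> sqrt (real ?r) * c"
      by (rule power2_le_imp_le) (use c \<delta> in simp)
    thus ?thesis using min[OF x] by simp
  qed
  hence "b / sqrt (real ?r) \<le> c" if "\<delta> < c" for c
    using that r by (simp add: pos_divide_le_eq mult.commute)
  hence "b / sqrt (real ?r) \<le> \<delta>" by (rule dense_ge)
  thus ?thesis unfolding \<delta>_def using r by (simp add: pos_divide_le_eq mult.commute)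
qed

section \<open>Korkhine-Zolotarev and reciprocal Korkhine-Zolotarev reduction\<close>

lemma proj_basis_vec_0:
  assumes j: "j < dim_col B"
  shows "proj_basis_vec B j 0 = col B j"
proof (rule eq_vecI)
  let ?F = "finsum_vec TYPE(real) (dim_row B) (\<lambda>l. gs_mu B j l \<cdot>\<^sub>v gs B l) {0..<j}"
  have carr: "(\<lambda>l. gs_mu B j l \<cdot>\<^sub>v gs B l) \<in> {0..<j} \<rightarrow> carrier_vec (dim_row B)"
    using j gs_carrier[of _ B] by auto
  have F: "?F \<in> carrier_vec (dim_row B)"
    using carr by (rule finsum_vec_closed)
  show "dim_vec (proj_basis_vec B j 0) = dim_vec (col B j)"
    using F gs_carrier[OF j] unfolding proj_basis_vec_def by simp
  fix k assume "k < dim_vec (col B j)"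
  hence k: "k < dim_row B" by simp
  have "?F $ k = (\<Sum>l\<in>{0..<j}. (gs_mu B j l \<cdot>\<^sub>v gs B l) $ k)"
    using carr k by (intro index_finsum_vec) auto
  also have "\<dots> = (\<Sum>l<j. gs_mu B j l * gs B l $ k)"
    unfolding atLeast0LessThan
  proof (intro sum.cong refl)
    fix l assume "l \<in> {..<j}"
    hence "gs B l \<in> carrier_vec (dim_row B)" using j by (intro gs_carrier) auto
    thus "(gs_mu B j l \<cdot>\<^sub>v gs B l) $ k = gs_mu B j l * gs B l $ k" using k by simp
  qed
  finally show "proj_basis_vec B j 0 $ k = col B j $ k"
    using F gs_decomp[OF j k] gs_carrier[OF j] k unfolding proj_basis_vec_def
    by (simp del: index_col)
qed

text \<open>At index 0 nothing is projected away, so \<open>proj_lattice B 0\<close> is the lattice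
  itself and the KZ condition there makes \<open>col B 0\<close> a shortest nonzero vector.
  Independence keeps the image of a nonzero \<open>x\<close> nonzero.\<close>

lemma kz_reduced_col_0_le:
  assumes B: "indep_cols B" "kz_reduced B" and r: "0 < dim_col B"
    and x: "x \<in> carrier_vec (dim_col B)" "x \<noteq> 0\<^sub>v (dim_col B)"
  shows "vnorm (col B 0) \<le> vnorm (B *\<^sub>v real_vec x)"
proof -
  have "map (\<lambda>j. proj_basis_vec B j 0) [0..<dim_col B] = cols B"
    by (intro nth_equalityI) (auto simp: proj_basis_vec_0)
  hence "proj_lattice B 0 = lattice_of B"
    unfolding proj_lattice_def by simp
  hence "is_shortest_nonzero (col B 0) (lattice_of B)"
    using B(2) r unfolding kz_reduced_def by (metis proj_basis_vec_0)
  moreover have "B *\<^sub>v real_vec x \<in> lattice_of B"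
    unfolding lattice_of_def using x(1) by blast
  moreover have "B *\<^sub>v real_vec x \<noteq> 0\<^sub>v (dim_vec (B *\<^sub>v real_vec x))"
  proof
    assume "B *\<^sub>v real_vec x = 0\<^sub>v (dim_vec (B *\<^sub>v real_vec x))"
    hence "real_vec x = 0\<^sub>v (dim_col B)"
      using B(1) x(1) unfolding indep_cols_def by auto
    thus False using x(2) by simp
  qed
  ultimately show ?thesis unfolding is_shortest_nonzero_def by blast
qed

text \<open>All lattice vectors lie in the column space of \<open>B\<close>, hence so does their
  linear span.\<close>

lemma reciprocal_lattice_subset_range:
  assumes v: "v \<in> reciprocal_lattice (dim_row B) (lattice_of B)"
  shows "\<exists>x\<in>carrier_vec (dim_col B). v = B *\<^sub>v x"
proof -
  interpret vec_space "TYPE(real)" "dim_row B" .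
  have eq: "span (set (cols B)) =
      {y \<in> carrier_vec (dim_row B). \<exists>x\<in>carrier_vec (dim_col B). B *\<^sub>v x = y}"
    using col_space_eq[of B "dim_col B"] unfolding col_space_def by auto
  have "Defs.lattice_of B \<subseteq> span (set (cols B))"
    unfolding eq Defs.lattice_of_def by (auto intro!: carrier_vecI)
  hence "span (Defs.lattice_of B) \<subseteq> span (set (cols B))"
    by (intro span_subsetI) (auto simp: cols_dim)
  thus ?thesis using v unfolding reciprocal_lattice_def eq by auto
qed

text \<open>Write \<open>B' = B * K\<close> and let \<open>P\<close> be the matrix of inner products
  of the two bases. Then \<open>det P\<close> is the Gram determinant of \<open>B\<close> times
  \<open>det K\<close>, while the Gram determinant of \<open>B'\<close> is
  \<open>det K * det P\<close>; the product of the two Gram determinants is therefore the square of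
  \<open>det P\<close>.\<close>

lemma det_gram_reciprocal_basis:
  assumes B: "indep_cols B" and B': "is_reciprocal_basis B B'"
  shows "det (transpose_mat B' * B') * det (transpose_mat B * B) = 1"
proof -
  let ?r = "dim_col B" and ?n = "dim_row B"
  \<comment> \<open>The reversal permutation, an involution: with indices from 0, vector
    \<open>i\<close> is dual to vector \<open>?r - 1 - i\<close>.\<close>
  define P where "P = mat ?r ?r (\<lambda>(i, j). if i + j + 1 = ?r then 1 else 0 :: real)"
  have B'c: "B' \<in> carrier_mat ?n ?r" using B' by (simp add: is_reciprocal_basis_def)
  have Bc: "B \<in> carrier_mat ?n ?r" by simp
  have P: "P \<in> carrier_mat ?r ?r" by (simp add: P_def)
  have PBB: "transpose_mat B * B' = P"
    using B' B'c by (intro eq_matI) (auto simp: P_def is_reciprocal_basis_def)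
  have "P * P = 1\<^sub>m ?r"
  proof (rule eq_matI)
    fix i j assume "i < dim_row (1\<^sub>m ?r)" "j < dim_col (1\<^sub>m ?r)"
    hence ij: "i < ?r" "j < ?r" by auto
    have "(P * P) $$ (i, j) = (\<Sum>k\<in>{0..<?r}. (if i + k + 1 = ?r then 1 else 0) * (if k + j + 1 = ?r then 1 else 0))"
      using ij by (simp add: P_def scalar_prod_def)
    also have "\<dots> = (\<Sum>k\<in>{0..<?r}. if k = ?r - Suc i then (if i = j then 1 else 0) else 0)"
      using ij by (intro sum.cong) auto
    finally show "(P * P) $$ (i, j) = 1\<^sub>m ?r $$ (i, j)"
      using ij by simp
  qed (auto simp: P_def)
  hence detP: "det P * det P = 1"
    using det_mult[OF P P] by simp
  \<comment> \<open>Each column of \<open>B'\<close> belongs to the reciprocal lattice and so to the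
    range of \<open>B\<close>; the coefficient vectors are the columns of \<open>K\<close>.\<close>
  have "\<exists>x\<in>carrier_vec ?r. col B' j = B *\<^sub>v x" if j: "j < ?r" for j
  proof (rule reciprocal_lattice_subset_range)
    have "col B' j = B' *\<^sub>v real_vec (unit_vec (dim_col B') j)"
    proof -
      have "real_vec (unit_vec (dim_col B') j) = unit_vec (dim_col B') j"
        by (intro eq_vecI) (auto simp: unit_vec_def)
      thus ?thesis using j B'c mult_unit_vec[of j B'] by simp
    qed
    moreover have "unit_vec (dim_col B') j \<in> carrier_vec (dim_col B')" by simp
    ultimately have "col B' j \<in> lattice_of B'" unfolding lattice_of_def by blast
    thus "col B' j \<in> reciprocal_lattice (dim_row B) (lattice_of B)"
      using B' by (simp add: is_reciprocal_basis_def is_lattice_basis_def)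
  qed
  then obtain k where k: "\<And>j. j < ?r \<Longrightarrow> k j \<in> carrier_vec ?r" "\<And>j. j < ?r \<Longrightarrow> col B' j = B *\<^sub>v k j"
    by metis
  define K where "K = mat_of_cols ?r (map k [0..<?r])"
  have K: "K \<in> carrier_mat ?r ?r" by (simp add: K_def mat_of_cols_carrier(1)[of ?r "map k [0..<?r]", simplified])
  have B'K: "B' = B * K"
  proof (rule mat_col_eqI)
    fix j assume "j < dim_col (B * K)"
    hence j: "j < ?r" using K by simp
    have "col (B * K) j = B *\<^sub>v col K j" by (rule col_mult2[OF Bc K j])
    also have "col K j = k j" unfolding K_def using j k(1)[OF j] by (subst col_mat_of_cols) auto
    finally show "col B' j = col (B * K) j" using k(2)[OF j] by simp
  qed (use B'c K in auto)
  have "det P = det (transpose_mat B * B) * det K"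
    unfolding PBB[symmetric] B'K
    by (subst assoc_mult_mat[symmetric, OF _ Bc K, of _ ?r], simp, rule det_mult[OF _ K]) auto
  moreover have "transpose_mat B' * B' = transpose_mat K * P"
  proof -
    have "transpose_mat B' = transpose_mat K * transpose_mat B"
      unfolding B'K by (rule transpose_mult[OF Bc K])
    hence "transpose_mat B' * B' = transpose_mat K * (transpose_mat B * B')"
      using K B'c by (simp only: assoc_mult_mat[of _ ?r ?r _ ?n _ ?r] transpose_carrier_mat Bc)
    thus ?thesis by (simp add: PBB)
  qed
  hence "det (transpose_mat B' * B') = det K * det P"
    using det_mult[of "transpose_mat K" ?r P] K P by (simp add: det_transpose)
  ultimately have "det (transpose_mat B' * B') * det (transpose_mat B * B) = det P * det P"
    by simp
  thus ?thesis by (simp add: detP)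
qed

lemma rkz_reduced_last_coord_le:
  assumes B: "indep_cols B" "rkz_reduced B" and r: "0 < dim_col B"
    and y: "y \<in> carrier_vec (dim_col B)"
  shows "\<bar>y $ (dim_col B - 1)\<bar> * det (transpose_mat B * B) powr (1 / (2 * real (dim_col B)))
           \<le> sqrt (real (dim_col B)) * vnorm (B *\<^sub>v y)"
proof -
  let ?r = "dim_col B" and ?n = "dim_row B"
  obtain B' where B': "is_reciprocal_basis B B'" "kz_reduced B'"
    using B(2) unfolding rkz_reduced_def by blast
  have B'c: "B' \<in> carrier_mat ?n ?r" and ind: "indep_cols B'"
    using B'(1) by (auto simp: is_reciprocal_basis_def is_lattice_basis_def)
  let ?D = "det (transpose_mat B * B)" and ?D' = "det (transpose_mat B' * B')"
  have D: "0 < ?D" "0 < ?D'" using det_gram_pos B(1) ind by auto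
  have DD: "?D' * ?D = 1" by (rule det_gram_reciprocal_basis[OF B(1) B'(1)])
  define c where "c = col B' 0"
  have c: "c \<in> carrier_vec ?n" unfolding c_def carrier_vec_def using B'c by auto
  have "vnorm c \<le> sqrt (real ?r) * ?D' powr (1 / (2 * real ?r))"
    using le_sqrt_dim_mult_det_gram[OF ind, of "vnorm c"] kz_reduced_col_0_le[OF ind B'(2)] r B'c
    by (auto simp: c_def)
  hence "vnorm c * ?D powr (1 / (2 * real ?r))
      \<le> sqrt (real ?r) * ?D' powr (1 / (2 * real ?r)) * ?D powr (1 / (2 * real ?r))"
    by (rule mult_right_mono) simp
  also have "\<dots> = sqrt (real ?r)"
    using D DD by (simp add: mult.assoc powr_mult[symmetric])
  finally have c_le: "vnorm c * ?D powr (1 / (2 * real ?r)) \<le> sqrt (real ?r)" .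
  \<comment> \<open>By the reversed numbering the first reciprocal vector is dual to the last basis
    vector, so pairing with \<open>c\<close> reads off the last coordinate.\<close>
  have "transpose_mat B *\<^sub>v c = unit_vec ?r (?r - 1)"
    using B'(1) r by (intro eq_vecI) (auto simp: c_def is_reciprocal_basis_def)
  hence "y $ (?r - 1) = (transpose_mat B *\<^sub>v c) \<bullet> y"
    using r y by (simp add: scalar_prod_left_unit)
  also have "\<dots> = c \<bullet> (B *\<^sub>v y)"
    using transpose_vec_mult_scalar[OF _ y c, of B] by simp
  finally have "\<bar>y $ (?r - 1)\<bar> \<le> vnorm c * vnorm (B *\<^sub>v y)"
    using Cauchy_Schwarz_vnorm[OF c, of "B *\<^sub>v y"] by (simp add: carrier_vecI)
  hence "\<bar>y $ (?r - 1)\<bar> * ?D powr (1 / (2 * real ?r))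
      \<le> vnorm c * vnorm (B *\<^sub>v y) * ?D powr (1 / (2 * real ?r))"
    by (rule mult_right_mono) simp
  also have "\<dots> = vnorm c * ?D powr (1 / (2 * real ?r)) * vnorm (B *\<^sub>v y)" by simp
  also have "\<dots> \<le> sqrt (real ?r) * vnorm (B *\<^sub>v y)"
    by (rule mult_right_mono[OF c_le vnorm_ge_0])
  finally show ?thesis .
qed

section \<open>LLL reduction\<close>

lemma lll_reduced_gs_le_double:
  assumes B: "lll_reduced B" and i: "Suc i < dim_col B"
  shows "gs B i \<bullet> gs B i \<le> 2 * (gs B (Suc i) \<bullet> gs B (Suc i))"
proof -
  let ?g = "gs B i" and ?h = "gs B (Suc i)" and ?m = "gs_mu B (Suc i) i" and ?n = "dim_row B"
  have g: "?g \<in> carrier_vec ?n" and h: "?h \<in> carrier_vec ?n" using i gs_carrier by auto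
  have orth: "?h \<bullet> ?g = 0" "?g \<bullet> ?h = 0"
    using gs_orthogonal[of i "Suc i" B] i comm_scalar_prod[OF g h] by auto
  \<comment> \<open>The cross terms in the exchange condition vanish by orthogonality. Size
    reduction bounds \<open>?m\<close> squared by 1/4, and the remaining 3/4 - 1/4 = 1/2 is the
    source of the factor 2.\<close>
  have "3 / 4 * (?g \<bullet> ?g) \<le> (?m \<cdot>\<^sub>v ?g + ?h) \<bullet> (?m \<cdot>\<^sub>v ?g + ?h)"
    using B i unfolding lll_reduced_def by (force simp: vnorm_power2)
  also have "\<dots> = ?m\<^sup>2 * (?g \<bullet> ?g) + ?h \<bullet> ?h"
    using g h orth
    by (simp add: add_scalar_prod_distrib[of _ ?n] scalar_prod_add_distrib[of _ ?n] power2_eq_square)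
  also have "?m\<^sup>2 * (?g \<bullet> ?g) \<le> 1 / 4 * (?g \<bullet> ?g)"
  proof (rule mult_right_mono[OF _ scalar_prod_self_ge_0])
    have "\<bar>?m\<bar> \<le> 1 / 2" using B i unfolding lll_reduced_def by auto
    hence "\<bar>?m\<bar>\<^sup>2 \<le> (1 / 2)\<^sup>2" by (intro power_mono) auto
    thus "?m\<^sup>2 \<le> 1 / 4" by (simp add: power2_eq_square)
  qed
  finally show ?thesis by simp
qed

lemma lll_reduced_gs_le_last:
  assumes B: "lll_reduced B" and "j < dim_col B"
  shows "gs B j \<bullet> gs B j \<le> 2 ^ (dim_col B - Suc j) * (gs B (dim_col B - 1) \<bullet> gs B (dim_col B - 1))"
proof -
  let ?r = "dim_col B"
  have "gs B (?r - Suc k) \<bullet> gs B (?r - Suc k) \<le> 2 ^ k * (gs B (?r - 1) \<bullet> gs B (?r - 1))" if "k < ?r" for k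
    using that
  proof (induction k)
    case (Suc k)
    have "Suc (?r - Suc (Suc k)) = ?r - Suc k" using Suc.prems by simp
    hence "gs B (?r - Suc (Suc k)) \<bullet> gs B (?r - Suc (Suc k)) \<le> 2 * (gs B (?r - Suc k) \<bullet> gs B (?r - Suc k))"
      using lll_reduced_gs_le_double[OF B, of "?r - Suc (Suc k)"] Suc.prems by simp
    then show ?case using Suc by simp
  qed simp
  from this[of "?r - Suc j"] assms(2) show ?thesis by simp
qed

text \<open>Squaring avoids halving the exponent of the product.\<close>

lemma prod_power2_square: "(\<Prod>j<r. 2 ^ j :: real)\<^sup>2 = 2 ^ (r * (r - 1))"
proof (induction r)
  case (Suc r)
  have "r * (r - 1) + 2 * r = Suc r * r" by (cases r) auto
  thus ?case using Suc
    by (simp add: power_mult_distrib power_mult[symmetric] power_add[symmetric] mult.commute)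
qed simp

text \<open>By \<open>lll_reduced_gs_le_last\<close> the factor of index \<open>j\<close> in the
  Gram determinant is at most \<open>2 ^ (r - 1 - j) * g\<close>, where \<open>r\<close> is the
  number of columns and \<open>g\<close> the last factor. The powers of 2 multiply to exponent
  r(r-1)/2, of which the root of order 2r leaves (r-1)/4.\<close>

lemma lll_reduced_det_gram_le:
  assumes B: "indep_cols B" "lll_reduced B" and r: "0 < dim_col B"
  shows "det (transpose_mat B * B) powr (1 / (2 * real (dim_col B)))
           \<le> 2 powr ((real (dim_col B) - 1) / 4) * vnorm (gs B (dim_col B - 1))"
proof -
  let ?r = "dim_col B" and ?D = "det (transpose_mat B * B)"
  define g where "g = gs B (?r - 1) \<bullet> gs B (?r - 1)"
  have g: "0 < g" using gs_self_pos[OF B(1), of "?r - 1"] r by (simp add: g_def)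
  have D: "0 < ?D" by (rule det_gram_pos[OF B(1)])
  have "?D \<le> (\<Prod>j<?r. 2 ^ (?r - Suc j) * g)"
    unfolding det_gram g_def using lll_reduced_gs_le_last[OF B(2)] scalar_prod_self_ge_0
    by (intro prod_mono) auto
  also have "\<dots> = (\<Prod>j<?r. 2 ^ j) * g ^ ?r"
    by (simp add: prod.distrib prod.nat_diff_reindex[of "\<lambda>j. 2 ^ j"])
  \<comment> \<open>The estimate is squared to fit \<open>prod_power2_square\<close>; a root of
    order \<open>4 * ?r\<close> is taken afterwards.\<close>
  finally have "?D\<^sup>2 \<le> ((\<Prod>j<?r. 2 ^ j) * g ^ ?r)\<^sup>2"
    using D by (intro power_mono) auto
  also have "\<dots> = 2 ^ (?r * (?r - 1)) * g ^ (2 * ?r)"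
    by (simp add: power_mult_distrib prod_power2_square power_mult[symmetric] mult.commute)
  also have "\<dots> = 2 powr (real ?r * (real ?r - 1)) * g powr (2 * real ?r)"
    using g r powr_realpow[of "2 :: real" "?r * (?r - 1)"] powr_realpow[of g "2 * ?r"]
    by (simp add: of_nat_diff)
  finally have le: "?D\<^sup>2 \<le> 2 powr (real ?r * (real ?r - 1)) * g powr (2 * real ?r)" .
  have "?D powr (1 / (2 * real ?r)) = (?D\<^sup>2) powr (1 / (4 * real ?r))"
    unfolding powr_numeral[OF less_imp_le[OF D], symmetric] powr_powr by simp
  also have "\<dots> \<le> (2 powr (real ?r * (real ?r - 1)) * g powr (2 * real ?r)) powr (1 / (4 * real ?r))"
    by (rule powr_mono2[OF _ _ le]) auto
  also have "\<dots> = 2 powr ((real ?r - 1) / 4) * g powr (1 / 2)"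
    using r by (simp add: powr_mult powr_powr)
  finally show ?thesis
    using g by (simp add: powr_half_sqrt vnorm_def g_def)
qed

text \<open>Keep only the last term of the sum in \<open>norm_mult_mat_vec\<close>: no index follows
  the last one, so its form is the coordinate itself.\<close>

lemma gs_last_coord_le:
  assumes r: "0 < dim_col B" and y: "y \<in> carrier_vec (dim_col B)"
  shows "\<bar>y $ (dim_col B - 1)\<bar> * vnorm (gs B (dim_col B - 1)) \<le> vnorm (B *\<^sub>v y)"
proof (rule power2_le_imp_le[OF _ vnorm_ge_0])
  let ?r = "dim_col B"
  let ?f = "\<lambda>j. gs B j \<bullet> gs B j * (y $ j + (\<Sum>i\<in>{j<..<?r}. gs_mu B i j * y $ i))\<^sup>2"
  have "{?r - 1<..<?r} = {}" by auto
  hence "(\<bar>y $ (?r - 1)\<bar> * vnorm (gs B (?r - 1)))\<^sup>2 = ?f (?r - 1)"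
    by (simp add: power_mult_distrib vnorm_power2)
  also have "\<dots> \<le> (\<Sum>j<?r. ?f j)"
    using r by (intro member_le_sum) (auto intro!: mult_nonneg_nonneg scalar_prod_self_ge_0)
  finally show "(\<bar>y $ (?r - 1)\<bar> * vnorm (gs B (?r - 1)))\<^sup>2 \<le> (vnorm (B *\<^sub>v y))\<^sup>2"
    by (simp add: norm_mult_mat_vec[OF y])
qed

lemma lll_reduced_last_coord_le:
  assumes B: "indep_cols B" "lll_reduced B" and r: "0 < dim_col B"
    and y: "y \<in> carrier_vec (dim_col B)"
  shows "\<bar>y $ (dim_col B - 1)\<bar> * det (transpose_mat B * B) powr (1 / (2 * real (dim_col B)))
           \<le> 2 powr ((real (dim_col B) - 1) / 4) * vnorm (B *\<^sub>v y)"
proof -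
  let ?y = "\<bar>y $ (dim_col B - 1)\<bar>" and ?c = "2 powr ((real (dim_col B) - 1) / 4)"
  have "?y * det (transpose_mat B * B) powr (1 / (2 * real (dim_col B)))
      \<le> ?y * (?c * vnorm (gs B (dim_col B - 1)))"
    by (rule mult_left_mono[OF lll_reduced_det_gram_le[OF B r]]) simp
  also have "\<dots> = ?c * (?y * vnorm (gs B (dim_col B - 1)))" by simp
  also have "\<dots> \<le> ?c * vnorm (B *\<^sub>v y)"
    by (rule mult_left_mono[OF gs_last_coord_le[OF r y]]) simp
  finally show ?thesis .
qed

section \<open>Determinants\<close>

text \<open>Sylvester's identity. Multiplying \<open>?M\<close> by the block unitriangular
  \<open>?U\<close> or \<open>?L\<close> clears one off-diagonal block, leaving one of the two sides
  as the determinant.\<close>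

lemma det_one_plus_mult_commute:
  fixes A C :: "'a :: idom mat"
  assumes A: "A \<in> carrier_mat m n" and C: "C \<in> carrier_mat n m"
  shows "det (A * C + 1\<^sub>m m) = det (C * A + 1\<^sub>m n)"
proof -
  let ?M = "four_block_mat (1\<^sub>m m) (- A) C (1\<^sub>m n)"
  let ?U = "four_block_mat (1\<^sub>m m) A (0\<^sub>m n m) (1\<^sub>m n)"
  let ?L = "four_block_mat (1\<^sub>m m) (0\<^sub>m m n) (- C) (1\<^sub>m n)"
  have M: "?M \<in> carrier_mat (m + n) (m + n)" and U: "?U \<in> carrier_mat (m + n) (m + n)"
    and L: "?L \<in> carrier_mat (m + n) (m + n)"
    using A C by auto
  have "?M * ?U = four_block_mat (1\<^sub>m m) (0\<^sub>m m n) C (C * A + 1\<^sub>m n)"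
    using A C by (subst mult_four_block_mat[where ?nr1.0 = m and ?n1.0 = m and ?n2.0 = n and ?nr2.0 = n and ?nc1.0 = m and ?nc2.0 = n]) auto
  hence "det ?M * det ?U = det (C * A + 1\<^sub>m n)"
    using A C by (subst det_mult[OF M U, symmetric])
      (simp add: det_four_block_mat_upper_right_zero[where n = m and m = n])
  moreover have "?M * ?L = four_block_mat (A * C + 1\<^sub>m m) (- A) (0\<^sub>m n m) (1\<^sub>m n)"
  proof -
    have "1\<^sub>m m * 1\<^sub>m m + - A * - C = A * C + 1\<^sub>m m"
      using A C comm_add_mat[of "A * C" m m "1\<^sub>m m"] by simp
    moreover have "C * 1\<^sub>m m + 1\<^sub>m n * - C = 0\<^sub>m n m" using C by auto
    ultimately show ?thesis
    using A C by (subst mult_four_block_mat[where ?nr1.0 = m and ?n1.0 = m and ?n2.0 = n and ?nr2.0 = n and ?nc1.0 = m and ?nc2.0 = n]) auto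
  qed
  hence "det ?M * det ?L = det (A * C + 1\<^sub>m m)"
    using A C by (subst det_mult[OF M L, symmetric])
      (simp add: det_four_block_mat_lower_left_zero[where n = m and m = n])
  moreover have "det ?U = 1" "det ?L = 1"
    using A C by (simp_all add: det_four_block_mat_lower_left_zero[where n = m and m = n]
        det_four_block_mat_upper_right_zero[where n = m and m = n])
  ultimately show ?thesis by simp
qed

section \<open>Maximal minors and their greatest common divisor\<close>

lemma less_if_less_Suc_below:
  fixes f :: "nat \<Rightarrow> nat"
  assumes "\<And>i. Suc i < m \<Longrightarrow> f i < f (Suc i)" "i < j" "j < m"
  shows "f i < f j"
  using assms(2,3)
proof (induction j)
  case (Suc j)
  then show ?case
    using assms(1)[of j] by (cases "i = j") auto
qed simp

text \<open>\<open>pick\<close> enumerates a set in increasing order, and exactly \<open>i\<close>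
  elements of the image lie below \<open>f i\<close>. This identifies the pivot columns in the order
  in which \<open>submatrix\<close> lists them.\<close>

lemma pick_strict_mono_image:
  fixes f :: "nat \<Rightarrow> nat"
  assumes f: "\<And>i j. i < j \<Longrightarrow> j < m \<Longrightarrow> f i < f j" and i: "i < m"
  shows "pick (f ` {..<m}) i = f i"
proof -
  have inj: "inj_on f {..<m}"
    using f by (intro linorder_inj_onI) (auto simp: less_imp_neq)
  have "{a \<in> f ` {..<m}. a < f i} = f ` {..<i}"
  proof (intro equalityI subsetI)
    fix a assume "a \<in> {a \<in> f ` {..<m}. a < f i}"
    then obtain j where j: "j < m" "a = f j" "f j < f i" by auto
    hence "j < i" using f[of i j] by (cases i j rule: linorder_cases) auto
    thus "a \<in> f ` {..<i}" using j by simp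
  qed (use f i in auto)
  moreover have "card (f ` {..<i}) = i"
    using inj_on_subset[OF inj, of "{..<i}"] i by (simp add: card_image)
  ultimately show ?thesis
    using pick_card_in_set[of "f i" "f ` {..<m}"] i by auto
qed

lemma submatrix_UNIV_carrier:
  assumes "A \<in> carrier_mat m n" "J \<subseteq> {..<n}"
  shows "submatrix A UNIV J \<in> carrier_mat m (card J)"
proof -
  have "{j. j < n \<and> j \<in> J} = J" using assms(2) by auto
  thus ?thesis using assms(1) by (intro carrier_matI) (auto simp: dim_submatrix)
qed

lemma submatrix_UNIV_index:
  assumes "A \<in> carrier_mat m n" "J \<subseteq> {..<n}" "i < m" "j < card J"
  shows "submatrix A UNIV J $$ (i, j) = A $$ (i, pick J j)" "pick J j < n"
proof -
  have J: "{j. j < n \<and> j \<in> J} = J" using assms(2) by auto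
  show "submatrix A UNIV J $$ (i, j) = A $$ (i, pick J j)"
    using assms J by (subst submatrix_index) (auto simp: pick_UNIV)
  show "pick J j < n" using pick_le[of j n J] assms(4) J by simp
qed

lemma submatrix_UNIV_mult:
  assumes A: "A \<in> carrier_mat k m" and C: "C \<in> carrier_mat m n" and J: "J \<subseteq> {..<n}"
  shows "submatrix (A * C) UNIV J = A * submatrix C UNIV J"
proof (rule eq_matI)
  have AC: "A * C \<in> carrier_mat k n" using A C by simp
  have S: "submatrix C UNIV J \<in> carrier_mat m (card J)" by (rule submatrix_UNIV_carrier[OF C J])
  have S': "submatrix (A * C) UNIV J \<in> carrier_mat k (card J)" by (rule submatrix_UNIV_carrier[OF AC J])
  show "dim_row (submatrix (A * C) UNIV J) = dim_row (A * submatrix C UNIV J)"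
    "dim_col (submatrix (A * C) UNIV J) = dim_col (A * submatrix C UNIV J)"
    using A S S' by auto
  fix i j assume "i < dim_row (A * submatrix C UNIV J)" "j < dim_col (A * submatrix C UNIV J)"
  hence i: "i < k" and j: "j < card J" using A S by auto
  have p: "pick J j < n" using submatrix_UNIV_index(2)[OF AC J i j] .
  have "col (submatrix C UNIV J) j = col C (pick J j)"
    using S C p j submatrix_UNIV_index(1)[OF C J _ j] by (intro eq_vecI) auto
  thus "submatrix (A * C) UNIV J $$ (i, j) = (A * submatrix C UNIV J) $$ (i, j)"
    using submatrix_UNIV_index(1)[OF AC J i j] A C S i j p by simp
qed

text \<open>Some maximal minor is nonzero: Gauss-Jordan elimination gives \<open>C = P * A\<close>
  with \<open>P\<close> invertible, and independent rows give every row of \<open>C\<close> a pivot.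
  The pivot columns of \<open>C\<close> form an identity matrix, so \<open>P\<close> inverts the
  corresponding submatrix of \<open>A\<close>.\<close>

lemma gcd_mat_pos:
  assumes A: "A \<in> carrier_mat m n" and ind: "indep_rows (real_mat A)"
  shows "0 < gcd_mat A"
proof -
  let ?R = "real_mat A"
  have R: "?R \<in> carrier_mat m n" using A by simp
  obtain C D where CD: "gauss_jordan ?R (0\<^sub>m m 0) = (C, D)" by force
  from gauss_jordan_transform[OF R _ CD, of 0 undefined]
  obtain P where PU: "P \<in> Units (ring_mat TYPE(real) m undefined)" and CP: "C = P * ?R"
    by auto
  from PU obtain P' where P: "P \<in> carrier_mat m m" and P': "P' \<in> carrier_mat m m" and PP': "P * P' = 1\<^sub>m m"
    unfolding Units_def ring_mat_def by auto
  have C: "C \<in> carrier_mat m n" using P R CP by simp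
  obtain f where f: "pivot_fun C f n"
    using gauss_jordan_row_echelon[OF R CD] C unfolding row_echelon_form_def by auto
  note piv = pivot_funD[OF _ f, of m]
  have dC: "dim_row C = m" using C by simp
  \<comment> \<open>A pivot position outside the matrix means that row \<open>i\<close> of
    \<open>C\<close> is zero. Then row \<open>i\<close> of \<open>P\<close> is a linear relation
    between the rows of \<open>A\<close>, so it vanishes, which the invertibility of
    \<open>P\<close> forbids.\<close>
  have fn: "f i < n" if i: "i < m" for i
  proof (rule ccontr)
    assume "\<not> f i < n"
    hence zero: "C $$ (i, j) = 0" if "j < n" for j
      using piv(2)[OF dC i] that by simp
    have p: "row P i \<in> carrier_vec m" using P i by auto
    have "transpose_mat ?R *\<^sub>v row P i = 0\<^sub>v n"
    proof (rule eq_vecI)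
      fix j assume "j < dim_vec (0\<^sub>v n :: real vec)"
      hence j: "j < n" by simp
      have "(transpose_mat ?R *\<^sub>v row P i) $ j = col ?R j \<bullet> row P i" using R j by simp
      also have "\<dots> = row P i \<bullet> col ?R j" using R by (intro comm_scalar_prod[OF _ p] carrier_vecI) simp
      also have "\<dots> = C $$ (i, j)" using CP P R i j by simp
      finally show "(transpose_mat ?R *\<^sub>v row P i) $ j = 0\<^sub>v n $ j" using zero[OF j] j by simp
    qed (use R in simp)
    hence "row P i = 0\<^sub>v m"
      using ind p R unfolding indep_rows_def indep_cols_def by simp
    hence "(P * P') $$ (i, i) = 0" using P P' i by simp
    thus False using PP' i by simp
  qed
  have "f i < f (Suc i)" if "Suc i < m" for i
    using piv(3)[OF dC, of i] fn[of "Suc i"] that by auto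
  hence mono: "f i < f j" if "i < j" "j < m" for i j
    using less_if_less_Suc_below[of m f i j] that by blast
  define J where "J = f ` {..<m}"
  have J: "J \<subseteq> {..<n}" using fn by (auto simp: J_def)
  have "inj_on f {..<m}" using mono by (intro linorder_inj_onI) (auto simp: less_imp_neq)
  hence cJ: "card J = m" by (simp add: J_def card_image)
  have S: "submatrix A UNIV J \<in> carrier_mat m m"
    using submatrix_UNIV_carrier[OF A J] cJ by simp
  have "P * submatrix ?R UNIV J = submatrix C UNIV J"
    unfolding CP using submatrix_UNIV_mult[OF P R J] by simp
  also have "\<dots> = 1\<^sub>m m"
  proof (rule eq_matI)
    fix i j assume "i < dim_row (1\<^sub>m m :: real mat)" "j < dim_col (1\<^sub>m m :: real mat)"
    hence ij: "i < m" "j < m" by auto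
    have "submatrix C UNIV J $$ (i, j) = C $$ (i, f j)"
      using submatrix_UNIV_index(1)[OF C J, of i j] ij cJ pick_strict_mono_image[of m f j] mono
      by (simp add: J_def)
    thus "submatrix C UNIV J $$ (i, j) = 1\<^sub>m m $$ (i, j)"
      using piv(4,5)[OF dC] fn ij by auto
  qed (use submatrix_UNIV_carrier[OF C J] cJ in auto)
  finally have "P * submatrix ?R UNIV J = 1\<^sub>m m" .
  moreover have "submatrix ?R UNIV J = real_mat (submatrix A UNIV J)"
    using submatrix_UNIV_carrier[OF R J] S cJ A submatrix_UNIV_index[OF A J] submatrix_UNIV_index[OF R J]
    by (intro eq_matI) auto
  ultimately have "det P * det (real_mat (submatrix A UNIV J)) = 1"
    using det_mult[OF P, of "real_mat (submatrix A UNIV J)"] S by simp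
  hence "det (submatrix A UNIV J) \<noteq> 0" by auto
  hence "gcd_mat A \<noteq> 0"
    using A J cJ unfolding gcd_mat_def by (auto simp: Gcd_0_iff)
  moreover have "0 \<le> gcd_mat A" unfolding gcd_mat_def by simp
  ultimately show ?thesis by simp
qed

text \<open>The columns of \<open>A * X\<close> turn out to be a basis of the lattice spanned by the columns of \<open>A\<close>: if
  a column of \<open>A\<close> had a non-integral coordinate, exchanging it (up to an integral combination) for
  the basis vector in question would shrink the determinant to the fractional part.\<close>

lemma ex_column_lattice_basis:
  fixes A :: "int mat"
  assumes A: "A \<in> carrier_mat m n" and nz: "det (A * transpose_mat A) \<noteq> 0"
  shows "\<exists>X\<in>carrier_mat n m. \<exists>Y\<in>carrier_mat m n. det (A * X) \<noteq> 0 \<and> A * X * Y = A"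
proof -
  let ?P = "\<lambda>X. X \<in> carrier_mat n m \<and> det (A * X) \<noteq> 0"
  \<comment> \<open>The transpose shows that there are candidates, so one with the least nonzero
    \<open>\<bar>det (A * X)\<bar>\<close> exists.\<close>
  have "?P (transpose_mat A)" using A nz by simp
  from ex_has_least_nat[where P = ?P and m = "\<lambda>X. nat \<bar>det (A * X)\<bar>", OF this]
  obtain X where X: "X \<in> carrier_mat n m" and dX: "det (A * X) \<noteq> 0"
    and min: "\<And>Z. Z \<in> carrier_mat n m \<Longrightarrow> det (A * Z) \<noteq> 0 \<Longrightarrow> \<bar>det (A * X)\<bar> \<le> \<bar>det (A * Z)\<bar>"
    by (auto simp: nat_le_eq_zle)
  define H where "H = A * X"
  define d where "d = det H"
  \<comment> \<open>\<open>C\<close> holds the numerators, over the common denominator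
    \<open>d\<close>, of the coordinates of the columns of \<open>A\<close> with respect to the
    columns of \<open>H\<close>.\<close>
  define C where "C = adj_mat H * A"
  have H: "H \<in> carrier_mat m m" using A X by (simp add: H_def)
  have adj: "adj_mat H \<in> carrier_mat m m" using adj_mat(1)[OF H] .
  have C: "C \<in> carrier_mat m n" using adj A by (simp add: C_def)
  have d0: "d \<noteq> 0" using dX by (simp add: d_def H_def)
  have HC: "H * C = d \<cdot>\<^sub>m A"
  proof -
    have "H * C = (H * adj_mat H) * A"
      unfolding C_def by (rule assoc_mult_mat[OF H adj A, symmetric])
    also have "\<dots> = (d \<cdot>\<^sub>m 1\<^sub>m m) * A" using adj_mat(2)[OF H] by (simp add: d_def)
    also have "\<dots> = d \<cdot>\<^sub>m A" using A by (subst mult_smult_assoc_mat[of _ m m]) auto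
    finally show ?thesis .
  qed
  have dvd: "d dvd C $$ (i, k)" if i: "i < m" and k: "k < n" for i k
  proof (rule ccontr)
    assume ndvd: "\<not> d dvd C $$ (i, k)"
    \<comment> \<open>Subtracting \<open>q\<close> times column \<open>i\<close> of \<open>H\<close>
      from column \<open>k\<close> of \<open>A\<close> leaves the coordinate
      \<open>(C $$ (i, k) mod d) / d\<close> at index \<open>i\<close>. The vector \<open>v\<close>
      expresses the result through the columns of \<open>A\<close>, and \<open>x\<close> lists its
      coordinates with respect to \<open>H\<close>.\<close>
    define q where "q = C $$ (i, k) div d"
    define v where "v = unit_vec n k - q \<cdot>\<^sub>v col X i"
    define Z where "Z = replace_col X v i"
    have v: "v \<in> carrier_vec n" using X by (intro carrier_vecI) (simp add: v_def)
    have Z: "Z \<in> carrier_mat n m" using X by (simp add: Z_def replace_col_def)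
    define x where "x = (1 / real_of_int d) \<cdot>\<^sub>v real_vec (col C k) - real_of_int q \<cdot>\<^sub>v unit_vec m i"
    have x: "x \<in> carrier_vec m" by (intro carrier_vecI) (simp add: x_def)
    have Hr: "real_mat H \<in> carrier_mat m m" using H by simp
    have Hx: "real_vec (A *\<^sub>v v) = real_mat H *\<^sub>v x"
    proof -
      have 1: "A *\<^sub>v v = col A k - q \<cdot>\<^sub>v col H i"
      proof -
        have "A *\<^sub>v v = A *\<^sub>v unit_vec n k - A *\<^sub>v (q \<cdot>\<^sub>v col X i)"
          unfolding v_def using A X by (intro mult_minus_distrib_mat_vec carrier_vecI) auto
        also have "A *\<^sub>v unit_vec n k = col A k" using mult_unit_vec[of k A] A k by simp
        also have "A *\<^sub>v (q \<cdot>\<^sub>v col X i) = q \<cdot>\<^sub>v (A *\<^sub>v col X i)"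
          using A X by (intro eq_vecI) auto
        also have "A *\<^sub>v col X i = col H i" unfolding H_def by (rule col_mult2[OF A X i, symmetric])
        finally show ?thesis .
      qed
      have "real_mat H *\<^sub>v x = real_mat H *\<^sub>v ((1 / real_of_int d) \<cdot>\<^sub>v real_vec (col C k))
          - real_mat H *\<^sub>v (real_of_int q \<cdot>\<^sub>v unit_vec m i)"
        unfolding x_def using Hr C by (intro mult_minus_distrib_mat_vec carrier_vecI) auto
      also have "real_mat H *\<^sub>v (real_of_int q \<cdot>\<^sub>v unit_vec m i) = real_of_int q \<cdot>\<^sub>v real_vec (col H i)"
        using mult_unit_vec[of i "real_mat H"] H i by (simp add: mult_mat_vec[OF Hr])
      also have "real_mat H *\<^sub>v ((1 / real_of_int d) \<cdot>\<^sub>v real_vec (col C k)) = real_vec (col A k)"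
      proof -
        have cC: "col C k \<in> carrier_vec m" using C by (intro carrier_vecI) simp
        have "real_mat H *\<^sub>v real_vec (col C k) = real_vec (col (H * C) k)"
          by (simp only: of_int_hom.mult_mat_vec_hom[OF H cC] col_mult2[OF H C k])
        also have "col (H * C) k = d \<cdot>\<^sub>v col A k" unfolding HC using A k by simp
        finally have "real_mat H *\<^sub>v real_vec (col C k) = real_of_int d \<cdot>\<^sub>v real_vec (col A k)"
          by (simp add: of_int_hom.vec_hom_smult)
        thus ?thesis using cC d0 by (simp add: mult_mat_vec[OF Hr] smult_smult_assoc)
      qed
      finally show ?thesis unfolding 1 using A H k i by (intro eq_vecI) auto
    qed
    have AZ: "A * Z = replace_col H (A *\<^sub>v v) i"
    proof (rule mat_col_eqI)
      fix b assume "b < dim_col (replace_col H (A *\<^sub>v v) i)"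
      hence b: "b < m" using H by (simp add: replace_col_def)
      have "col Z b = (if b = i then v else col X b)"
        using X v b by (intro eq_vecI) (auto simp: Z_def replace_col_def)
      moreover have "col (replace_col H (A *\<^sub>v v) i) b = (if b = i then A *\<^sub>v v else col H b)"
        using H A b by (intro eq_vecI) (auto simp: replace_col_def)
      ultimately show "col (A * Z) b = col (replace_col H (A *\<^sub>v v) i) b"
        unfolding col_mult2[OF A Z b] by (simp add: H_def col_mult2[OF A X b])
    qed (use A H Z in \<open>auto simp: replace_col_def\<close>)
    have "real_mat (A * Z) = replace_col (real_mat H) (real_mat H *\<^sub>v x) i"
      unfolding AZ Hx[symmetric] using H A by (intro eq_matI) (auto simp: replace_col_def)
    \<comment> \<open>Cramer's rule: exchanging column \<open>i\<close> of \<open>H\<close> for this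
      vector multiplies the determinant by its coordinate at \<open>i\<close>.\<close>
    hence "real_of_int (det (A * Z)) = x $ i * real_of_int d"
      using cramer_lemma_mat[OF Hr x i] by (metis d_def of_int_hom.hom_det)
    also have "x $ i = real_of_int (C $$ (i, k)) / real_of_int d - real_of_int q"
      using C i k by (simp add: x_def)
    also have "\<dots> * real_of_int d = real_of_int (C $$ (i, k) - q * d)"
      using d0 by (simp add: field_simps)
    also have "C $$ (i, k) - q * d = C $$ (i, k) mod d"
      by (simp add: q_def minus_div_mult_eq_mod)
    finally have "det (A * Z) = C $$ (i, k) mod d" by (simp only: of_int_eq_iff)
    moreover have "C $$ (i, k) mod d \<noteq> 0" using ndvd by (simp add: dvd_eq_mod_eq_0)
    moreover have "\<bar>C $$ (i, k) mod d\<bar> < \<bar>d\<bar>" using abs_mod_less[OF d0] .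
    ultimately show False using min[OF Z] by (simp add: d_def H_def)
  qed
  define Y where "Y = mat m n (\<lambda>(i, k). C $$ (i, k) div d)"
  have Y: "Y \<in> carrier_mat m n" by (simp add: Y_def)
  have "d \<cdot>\<^sub>m Y = C" using C dvd by (intro eq_matI) (auto simp: Y_def)
  hence "d \<cdot>\<^sub>m (H * Y) = d \<cdot>\<^sub>m A"
    using HC mult_smult_distrib[OF H Y, of d] by simp
  hence "H * Y = A"
  proof (intro eq_matI)
    fix i k assume eq: "d \<cdot>\<^sub>m (H * Y) = d \<cdot>\<^sub>m A" and "i < dim_row A" "k < dim_col A"
    hence ik: "i < m" "k < n" using A by auto
    have "(d \<cdot>\<^sub>m (H * Y)) $$ (i, k) = (d \<cdot>\<^sub>m A) $$ (i, k)" unfolding eq ..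
    hence "d * (H * Y) $$ (i, k) = d * A $$ (i, k)"
      using mult_carrier_mat[OF H Y] A ik by (simp del: index_mult_mat)
    thus "(H * Y) $$ (i, k) = A $$ (i, k)" using d0 by (simp del: index_mult_mat)
  qed (use H Y A in auto)
  thus ?thesis using X Y dX by (auto simp: H_def)
qed

section \<open>Gram determinants of integral matrices and of kernel bases\<close>

lemma det_gram_int:
  "real_of_int (det (transpose_mat B * B)) = det (transpose_mat (real_mat B) * real_mat B)"
proof -
  have "real_mat (transpose_mat B * B) = real_mat (transpose_mat B) * real_mat B"
    by (rule of_int_hom.mat_hom_mult[of _ "dim_col B" "dim_row B" _ "dim_col B"]) auto
  moreover have "real_mat (transpose_mat B) = transpose_mat (real_mat B)" by (intro eq_matI) auto
  ultimately show ?thesis by (simp flip: of_int_hom.hom_det)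
qed

lemma det_mult_transpose_le_gcd_mat:
  assumes A: "A \<in> carrier_mat m n" and ind: "indep_rows (real_mat A)" and mn: "m < n"
    and B: "B \<in> carrier_mat n (n - m)" and AB: "A * B = 0\<^sub>m m (n - m)"
    and indB: "indep_cols (real_mat B)"
  shows "0 < det (A * transpose_mat A)"
    and "det (A * transpose_mat A) \<le> (gcd_mat A)\<^sup>2 * det (transpose_mat B * B)"
proof -
  let ?k = "n - m" and ?At = "transpose_mat A" and ?Bt = "transpose_mat B"
  have At: "?At \<in> carrier_mat n m" and Bt: "?Bt \<in> carrier_mat ?k n" using A B by auto
  have "0 < real_of_int (det (A * ?At))"
  proof -
    have "transpose_mat (real_mat A) = real_mat ?At" by (intro eq_matI) auto
    hence "0 < det (transpose_mat (real_mat ?At) * real_mat ?At)"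
      using ind by (intro det_gram_pos) (simp add: indep_rows_def)
    thus ?thesis using det_gram_int[of ?At] by simp
  qed
  thus Apos: "0 < det (A * ?At)" by simp
  have "0 < real_of_int (det (?Bt * B))"
    unfolding det_gram_int by (rule det_gram_pos[OF indB])
  hence Bpos: "0 < det (?Bt * B)" by simp
  obtain X Y where X: "X \<in> carrier_mat n m" and Y: "Y \<in> carrier_mat m n"
    and dX: "det (A * X) \<noteq> 0" and AXY: "A * X * Y = A"
    using ex_column_lattice_basis[OF A] Apos by auto
  have AX: "A * X \<in> carrier_mat m m" using A X by simp
  \<comment> \<open>Since \<open>A = A * X * Y\<close>, every maximal minor of \<open>A\<close> is
    \<open>det (A * X)\<close> times the corresponding minor of \<open>Y\<close>.\<close>
  have "det (A * X) dvd gcd_mat A"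
    unfolding gcd_mat_def
  proof (rule Gcd_greatest, clarify)
    fix J assume "J \<subseteq> {..<dim_col A}" "card J = dim_row A"
    hence J: "J \<subseteq> {..<n}" and cJ: "card J = m" using A by auto
    have "submatrix A UNIV J = A * X * submatrix Y UNIV J"
      using submatrix_UNIV_mult[OF AX Y J] AXY by simp
    thus "det (A * X) dvd det (submatrix A UNIV J)"
      using det_mult[OF AX, of "submatrix Y UNIV J"] submatrix_UNIV_carrier[OF Y J] cJ by simp
  qed
  hence "\<bar>det (A * X)\<bar> \<le> gcd_mat A"
    using gcd_mat_pos[OF A ind] dvd_imp_le_int[of "gcd_mat A" "det (A * X)"] by simp
  hence gcd: "(det (A * X))\<^sup>2 \<le> (gcd_mat A)\<^sup>2"
    using abs_le_square_iff[of "det (A * X)" "gcd_mat A"] by simp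
  \<comment> \<open>Blocks without columns or without rows express stacking as
    \<open>four_block_mat\<close>: \<open>W\<close> is \<open>A\<close> above the transpose of
    \<open>B\<close>, and \<open>V\<close> is \<open>X\<close> beside \<open>B\<close>.\<close>
  define W where "W = four_block_mat A (0\<^sub>m m 0) ?Bt (0\<^sub>m ?k 0)"
  define V where "V = four_block_mat X B (0\<^sub>m 0 m) (0\<^sub>m 0 ?k)"
  have W: "W \<in> carrier_mat n n" and V: "V \<in> carrier_mat n n"
    using A B X mn by (auto simp: W_def V_def)
  have BtAt: "?Bt * ?At = 0\<^sub>m ?k m"
    using transpose_mult[OF A B] AB by simp
  have "transpose_mat W = four_block_mat ?At B (0\<^sub>m 0 m) (0\<^sub>m 0 ?k)"
    unfolding W_def using A Bt by (subst transpose_four_block_mat) auto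
  hence "W * transpose_mat W = four_block_mat (A * ?At) (0\<^sub>m m ?k) (0\<^sub>m ?k m) (?Bt * B)"
    unfolding W_def using A B At Bt AB BtAt
    by (simp add: mult_four_block_mat[where ?nr1.0 = m and ?n1.0 = n and ?n2.0 = 0 and ?nr2.0 = ?k
          and ?nc1.0 = m and ?nc2.0 = ?k])
  hence "det W * det W = det (A * ?At) * det (?Bt * B)"
    using det_mult[OF W, of "transpose_mat W"] W A B At Bt
    by (simp add: det_transpose det_four_block_mat_upper_right_zero[where n = m and m = ?k])
  hence WW: "(det W)\<^sup>2 = det (A * ?At) * det (?Bt * B)" by (simp add: power2_eq_square)
  have "W * V = four_block_mat (A * X) (0\<^sub>m m ?k) (?Bt * X) (?Bt * B)"
    unfolding W_def V_def using A B X Bt AB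
    by (simp add: mult_four_block_mat[where ?nr1.0 = m and ?n1.0 = n and ?n2.0 = 0 and ?nr2.0 = ?k
          and ?nc1.0 = m and ?nc2.0 = ?k])
  hence WV: "det W * det V = det (A * X) * det (?Bt * B)"
    using det_mult[OF W V] AX Bt B X
    by (simp add: det_four_block_mat_upper_right_zero[where n = m and m = ?k])
  \<comment> \<open>\<open>V\<close> is in fact unimodular, but a nonzero integral determinant is all that is needed.\<close>
  hence "det V \<noteq> 0" using dX Bpos by auto
  hence "1 \<le> (det V)\<^sup>2" by (simp add: int_one_le_iff_zero_less)
  \<comment> \<open>\<open>W * V\<close> is block triangular, so dropping \<open>det V\<close>
    bounds \<open>det W\<close> by the product of its diagonal determinants. One factor
    \<open>det (?Bt * B)\<close> then cancels against the formula \<open>WW\<close>.\<close>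
  hence "(det W)\<^sup>2 * 1 \<le> (det W)\<^sup>2 * (det V)\<^sup>2" by (intro mult_left_mono) auto
  also have "\<dots> = (det (A * X))\<^sup>2 * (det (?Bt * B))\<^sup>2"
    using WV by (metis power_mult_distrib)
  also have "\<dots> \<le> (gcd_mat A)\<^sup>2 * (det (?Bt * B))\<^sup>2"
    using gcd by (intro mult_right_mono) auto
  finally have "det (A * ?At) * det (?Bt * B) \<le> (gcd_mat A)\<^sup>2 * det (?Bt * B) * det (?Bt * B)"
    using WW by (simp add: power2_eq_square mult.assoc)
  thus "det (A * ?At) \<le> (gcd_mat A)\<^sup>2 * det (?Bt * B)"
    using Bpos by simp
qed

section \<open>Widths\<close>

lemma vnorm_mono:
  assumes "dim_vec v = dim_vec w" "\<And>k. k < dim_vec w \<Longrightarrow> \<bar>v $ k\<bar> \<le> \<bar>w $ k\<bar>"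
  shows "vnorm v \<le> vnorm w"
  unfolding vnorm_def scalar_prod_def assms(1)
proof (intro real_sqrt_le_mono sum_mono)
  fix k assume "k \<in> {0..<dim_vec w}"
  thus "v $ k * v $ k \<le> w $ k * w $ k"
    using assms(2)[of k] abs_le_square_iff[of "v $ k" "w $ k"] by (simp add: power2_eq_square)
qed

text \<open>A point of \<open>P\<close> and the bound \<open>D\<close> together make the infimum a
  real number \<open>a\<close>. Every coordinate is then at most \<open>a + D\<close>, and the
  extended-real difference is an ordinary one.\<close>

lemma width_unit_vec_le:
  assumes P: "P \<subseteq> carrier_vec r" "P \<noteq> {}" and i: "i < r"
    and bd: "\<And>x y. x \<in> P \<Longrightarrow> y \<in> P \<Longrightarrow> x $ i - y $ i \<le> D"
  shows "width (unit_vec r i) P \<le> ereal D"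
proof -
  have e: "real_vec (unit_vec r i) \<bullet> x = x $ i" if "x \<in> P" for x
  proof -
    have "real_vec (unit_vec r i) = unit_vec r i"
      by (intro eq_vecI) (auto simp: unit_vec_def)
    thus ?thesis using that P(1) i by (auto simp: scalar_prod_left_unit[of _ r])
  qed
  let ?S = "SUP x\<in>P. ereal (x $ i)" and ?I = "INF x\<in>P. ereal (x $ i)"
  have w: "width (unit_vec r i) P = ?S - ?I"
    unfolding width_def using e by (simp cong: SUP_cong INF_cong)
  have low: "ereal (x $ i - D) \<le> ?I" if "x \<in> P" for x
    using bd[OF that] by (intro INF_greatest) (simp add: algebra_simps)
  obtain z where z: "z \<in> P" using P(2) by blast
  have "?I \<le> ereal (z $ i)" using z by (rule INF_lower)
  then obtain a where a: "?I = ereal a"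
    using low[OF z] by (cases ?I) auto
  have "?S \<le> ereal (a + D)"
    using low unfolding a by (intro SUP_least) (simp add: algebra_simps)
  moreover have "ereal (z $ i) \<le> ?S" using z by (rule SUP_upper)
  ultimately show ?thesis unfolding w a by (cases ?S) auto
qed

text \<open>\<open>D\<close> stands for the root of the Gram determinant and \<open>K\<close> for
  the constant of the reduction notion; \<open>last\<close> is applied to the difference of two
  points.\<close>

lemma width_box_le:
  assumes B: "B \<in> carrier_mat k r" and r: "0 < r" and D: "0 < D" and K: "0 \<le> K"
    and ab: "a \<in> carrier_vec k" "b \<in> carrier_vec k"
    and last: "\<And>y. y \<in> carrier_vec r \<Longrightarrow> \<bar>y $ (r - 1)\<bar> * D \<le> K * vnorm (B *\<^sub>v y)"
    and ne: "{y \<in> carrier_vec r. a \<le> B *\<^sub>v y \<and> B *\<^sub>v y \<le> b} \<noteq> {}"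
  shows "width (unit_vec r (r - 1)) {y \<in> carrier_vec r. a \<le> B *\<^sub>v y \<and> B *\<^sub>v y \<le> b}
           \<le> ereal (K * vnorm (b - a) / D)"
proof (rule width_unit_vec_le)
  fix x y assume "x \<in> {y \<in> carrier_vec r. a \<le> B *\<^sub>v y \<and> B *\<^sub>v y \<le> b}"
    "y \<in> {y \<in> carrier_vec r. a \<le> B *\<^sub>v y \<and> B *\<^sub>v y \<le> b}"
  hence x: "x \<in> carrier_vec r" "a \<le> B *\<^sub>v x" "B *\<^sub>v x \<le> b"
    and y: "y \<in> carrier_vec r" "a \<le> B *\<^sub>v y" "B *\<^sub>v y \<le> b" by auto
  have xy: "B *\<^sub>v (x - y) = B *\<^sub>v x - B *\<^sub>v y"
    by (rule mult_minus_distrib_mat_vec[OF B x(1) y(1)])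
  have "vnorm (B *\<^sub>v x - B *\<^sub>v y) \<le> vnorm (b - a)"
  proof (rule vnorm_mono)
    show "dim_vec (B *\<^sub>v x - B *\<^sub>v y) = dim_vec (b - a)" using ab B by simp
    fix i assume "i < dim_vec (b - a)"
    hence i: "i < k" using ab by simp
    have "a $ i \<le> (B *\<^sub>v x) $ i" "(B *\<^sub>v x) $ i \<le> b $ i"
      "a $ i \<le> (B *\<^sub>v y) $ i" "(B *\<^sub>v y) $ i \<le> b $ i"
      using x(2,3) y(2,3) ab B i unfolding less_eq_vec_def by auto
    moreover have "(b - a) $ i = b $ i - a $ i"
      and "(B *\<^sub>v x - B *\<^sub>v y) $ i = (B *\<^sub>v x) $ i - (B *\<^sub>v y) $ i"
      using ab B i by simp_all
    ultimately show "\<bar>(B *\<^sub>v x - B *\<^sub>v y) $ i\<bar> \<le> \<bar>(b - a) $ i\<bar>" by linarith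
  qed
  have "(x $ (r - 1) - y $ (r - 1)) * D \<le> \<bar>(x - y) $ (r - 1)\<bar> * D"
    using y(1) r D by (intro mult_right_mono) auto
  also have "\<dots> \<le> K * vnorm (B *\<^sub>v x - B *\<^sub>v y)"
    unfolding xy[symmetric] using x(1) y(1) by (intro last) simp
  also have "\<dots> \<le> K * vnorm (b - a)"
    by (rule mult_left_mono) fact+
  finally show "x $ (r - 1) - y $ (r - 1) \<le> K * vnorm (b - a) / D"
    using D by (simp add: pos_le_divide_eq)
qed (use r ne in auto)

section \<open>The polyhedron \<open>Q_R\<close>\<close>

lemma stack_id_carrier: "A \<in> carrier_mat m n \<Longrightarrow> stack_id A \<in> carrier_mat (m + n) n"
  unfolding stack_id_def by (auto intro: carrier_append_rows)

lemma stack_id_gram: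
  assumes A: "A \<in> carrier_mat m n"
  shows "transpose_mat (stack_id A) * stack_id A = transpose_mat A * A + 1\<^sub>m n"
proof -
  have At: "transpose_mat A \<in> carrier_mat n m" using A by simp
  have S: "stack_id A = four_block_mat A (0\<^sub>m m 0) (1\<^sub>m n) (0\<^sub>m n 0)"
    using A by (simp add: stack_id_def append_rows_def)
  have "transpose_mat (stack_id A) = four_block_mat (transpose_mat A) (1\<^sub>m n) (0\<^sub>m 0 m) (0\<^sub>m 0 n)"
    unfolding S using A by (subst transpose_four_block_mat) auto
  hence "transpose_mat (stack_id A) * stack_id A =
      four_block_mat (transpose_mat A * A + 1\<^sub>m n) (0\<^sub>m n 0) (0\<^sub>m 0 n) (0\<^sub>m 0 0)"
    unfolding S using A At
    by (simp add: mult_four_block_mat[where ?nr1.0 = n and ?n1.0 = m and ?n2.0 = n and ?nr2.0 = 0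
          and ?nc1.0 = n and ?nc2.0 = 0])
  also have "\<dots> = transpose_mat A * A + 1\<^sub>m n"
    using A by (intro eq_matI) auto
  finally show ?thesis .
qed

text \<open>A unimodular change of basis keeps the Gram determinant, and Sylvester's identity moves
  it from size \<open>n\<close> to size \<open>m\<close>.\<close>

lemma det_gram_stack_id_mult:
  assumes A: "A \<in> carrier_mat m n" and U: "U \<in> carrier_mat n n" "\<bar>det U\<bar> = 1"
  shows "det (transpose_mat (stack_id A * U) * (stack_id A * U)) = det (A * transpose_mat A + 1\<^sub>m m)"
proof -
  let ?S = "stack_id A" and ?Ut = "transpose_mat U"
  have S: "?S \<in> carrier_mat (m + n) n" by (rule stack_id_carrier[OF A])
  have St: "transpose_mat ?S \<in> carrier_mat n (m + n)" and Ut: "?Ut \<in> carrier_mat n n"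
    using S U by auto
  have G: "transpose_mat ?S * ?S \<in> carrier_mat n n" using S by simp
  have "transpose_mat (?S * U) * (?S * U) = ?Ut * (transpose_mat ?S * ?S) * U"
    by (simp only: transpose_mult[OF S U(1)] assoc_mult_mat[OF Ut St mult_carrier_mat[OF S U(1)]]
        assoc_mult_mat[OF Ut G U(1)] assoc_mult_mat[OF St S U(1)])
  hence "det (transpose_mat (?S * U) * (?S * U)) = det U * det (transpose_mat ?S * ?S) * det U"
    by (simp add: det_mult[OF mult_carrier_mat[OF Ut G] U(1)] det_mult[OF Ut G] det_transpose[OF U(1)])
  also have "\<dots> = det (transpose_mat ?S * ?S) * (det U)\<^sup>2"
    by (simp add: power2_eq_square)
  also have "(det U)\<^sup>2 = 1" using U(2) by (metis power2_abs one_power2)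
  finally show ?thesis
    using A by (simp add: stack_id_gram det_one_plus_mult_commute[of A m n])
qed

text \<open>The reduction notion \<open>red\<close> enters only through the coordinate bound
  \<open>last\<close>, so one proof serves RKZ and LLL reduction.\<close>

lemma width_Q_R_le:
  assumes A: "A \<in> carrier_mat m n" and n: "0 < n"
    and l: "l1 \<in> carrier_vec m" "l2 \<in> carrier_vec n" and w: "w1 \<in> carrier_vec m" "w2 \<in> carrier_vec n"
    and R: "R_transform red A U" and ne: "Q_R A l1 w1 l2 w2 U \<noteq> {}" and K: "0 \<le> K"
    and last: "\<And>B y. indep_cols B \<Longrightarrow> red B \<Longrightarrow> dim_col B = n \<Longrightarrow> y \<in> carrier_vec n \<Longrightarrow>
      \<bar>y $ (n - 1)\<bar> * det (transpose_mat B * B) powr (1 / (2 * real n)) \<le> K * vnorm (B *\<^sub>v y)"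
  shows "width (unit_vec n (n - 1)) (Q_R A l1 w1 l2 w2 U)
    \<le> ereal (K * vnorm (real_vec ((w1 @\<^sub>v w2) - (l1 @\<^sub>v l2)))
         / real_of_int (det (A * transpose_mat A + 1\<^sub>m m)) powr (1 / (2 * real n)))"
proof -
  let ?B = "real_mat (stack_id A * U)"
  have U: "U \<in> carrier_mat n n" "\<bar>det U\<bar> = 1"
    and ind: "indep_cols ?B" and red: "red ?B"
    using R A by (auto simp: R_transform_def unimodular_def is_lattice_basis_def)
  have B: "?B \<in> carrier_mat (m + n) n" using stack_id_carrier[OF A] U(1) by simp
  have det: "det (transpose_mat ?B * ?B) = real_of_int (det (A * transpose_mat A + 1\<^sub>m m))"
    unfolding det_gram_int[symmetric] det_gram_stack_id_mult[OF A U] ..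
  have diff: "real_vec (w1 @\<^sub>v w2) - real_vec (l1 @\<^sub>v l2) = real_vec ((w1 @\<^sub>v w2) - (l1 @\<^sub>v l2))"
    using l w by (intro eq_vecI) auto
  have Q: "Q_R A l1 w1 l2 w2 U =
      {y \<in> carrier_vec n. real_vec (l1 @\<^sub>v l2) \<le> ?B *\<^sub>v y \<and> ?B *\<^sub>v y \<le> real_vec (w1 @\<^sub>v w2)}"
    using A by (simp add: Q_R_def)
  show ?thesis
    unfolding diff[symmetric] Q det[symmetric]
  proof (rule width_box_le[OF B n _ K])
    show "0 < det (transpose_mat ?B * ?B) powr (1 / (2 * real n))"
      using det_gram_pos[OF ind] by simp
    show "real_vec (l1 @\<^sub>v l2) \<in> carrier_vec (m + n)" "real_vec (w1 @\<^sub>v w2) \<in> carrier_vec (m + n)"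
      using l w by auto
    show "{y \<in> carrier_vec n. real_vec (l1 @\<^sub>v l2) \<le> ?B *\<^sub>v y \<and> ?B *\<^sub>v y \<le> real_vec (w1 @\<^sub>v w2)} \<noteq> {}"
      using ne unfolding Q .
  qed (rule last[OF ind red carrier_matD(2)[OF B]])
qed

section \<open>The polyhedron \<open>Q_N\<close>\<close>

lemma lattice_basis_of_int_vecs:
  assumes B: "is_lattice_basis B (real_vec ` S)"
  shows "\<exists>C. B = real_mat C \<and> dim_row C = dim_row B \<and> dim_col C = dim_col B \<and>
    (\<forall>j<dim_col B. col C j \<in> S)"
proof -
  let ?n = "dim_row B" and ?r = "dim_col B"
  \<comment> \<open>A unit coefficient vector shows that each basis column is itself a lattice
    vector.\<close>
  have "\<exists>v\<in>S. col B j = real_vec v" if j: "j < ?r" for j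
  proof -
    have "real_vec (unit_vec ?r j) = unit_vec ?r j"
      by (intro eq_vecI) (auto simp: unit_vec_def)
    hence "col B j = B *\<^sub>v real_vec (unit_vec ?r j)" using mult_unit_vec[OF j] by simp
    moreover have "unit_vec ?r j \<in> carrier_vec ?r" by simp
    ultimately have "col B j \<in> lattice_of B" unfolding lattice_of_def by blast
    thus ?thesis using B unfolding is_lattice_basis_def by blast
  qed
  then obtain v where v: "\<And>j. j < ?r \<Longrightarrow> v j \<in> S" "\<And>j. j < ?r \<Longrightarrow> col B j = real_vec (v j)"
    by metis
  define C where "C = mat ?n ?r (\<lambda>(i, j). v j $ i)"
  have dv: "dim_vec (v j) = ?n" if "j < ?r" for j
    using arg_cong[OF v(2)[OF that], of dim_vec] by simp
  have col_C: "col C j = v j" if "j < ?r" for j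
    using that dv[OF that] by (intro eq_vecI) (auto simp: C_def)
  have "B = real_mat C"
  proof (rule eq_matI)
    fix i j assume "i < dim_row (real_mat C)" "j < dim_col (real_mat C)"
    hence ij: "i < ?n" "j < ?r" by (auto simp: C_def)
    have "B $$ (i, j) = col B j $ i" using ij by simp
    also have "\<dots> = real_of_int (v j $ i)" using v(2)[OF ij(2)] dv[OF ij(2)] ij by simp
    finally show "B $$ (i, j) = real_mat C $$ (i, j)" using ij by (simp add: C_def)
  qed (auto simp: C_def)
  moreover have "dim_row C = ?n" "dim_col C = ?r" by (simp_all add: C_def)
  ultimately show ?thesis using col_C v(1) by metis
qed

lemma width_Q_N_le:
  assumes A: "A \<in> carrier_mat m n" and rows: "indep_rows (real_mat A)" and mn: "m < n"
    and l: "l2 \<in> carrier_vec n" and w: "w2 \<in> carrier_vec n"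
    and N: "N_transform red A l1 B x0" and ne: "Q_N l2 w2 B x0 \<noteq> {}" and K: "0 \<le> K"
    and last: "\<And>y. indep_cols B \<Longrightarrow> red B \<Longrightarrow> dim_col B = n - m \<Longrightarrow> y \<in> carrier_vec (n - m) \<Longrightarrow>
      \<bar>y $ (n - m - 1)\<bar> * det (transpose_mat B * B) powr (1 / (2 * real (n - m))) \<le> K * vnorm (B *\<^sub>v y)"
  shows "width (unit_vec (n - m) (n - m - 1)) (Q_N l2 w2 B x0)
    \<le> ereal (real_of_int (gcd_mat A) * K * vnorm (real_vec (w2 - l2))
         / real_of_int (det (A * transpose_mat A)) powr (1 / (2 * real (n - m))))"
proof -
  let ?r = "n - m"
  have r: "0 < ?r" using mn by simp
  have x0: "x0 \<in> carrier_vec n" and B: "B \<in> carrier_mat n ?r" and ind: "indep_cols B"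
    and red: "red B" and basis: "is_lattice_basis B (real_vec ` int_kernel A)"
    using N A by (auto simp: N_transform_def is_lattice_basis_def)
  \<comment> \<open>An integral version of the basis is required because the determinant comparison
    uses that a nonzero integer has absolute value at least 1.\<close>
  obtain C where BC: "B = real_mat C" and C: "C \<in> carrier_mat n ?r"
    and ker: "\<And>j. j < ?r \<Longrightarrow> col C j \<in> int_kernel A"
    using lattice_basis_of_int_vecs[OF basis] B by auto
  have "A * C = 0\<^sub>m m ?r"
  proof (rule mat_col_eqI)
    fix j assume "j < dim_col (0\<^sub>m m ?r :: int mat)"
    hence j: "j < ?r" by simp
    have "col (A * C) j = 0\<^sub>v m"
      unfolding col_mult2[OF A C j] using ker[OF j] A by (simp add: int_kernel_def)
    thus "col (A * C) j = col (0\<^sub>m m ?r) j" using j by simp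
  qed (use A C in auto)
  note AC = det_mult_transpose_le_gcd_mat[OF A rows mn C this ind[unfolded BC]]
  define dA where "dA = real_of_int (det (A * transpose_mat A))"
  define dB where "dB = det (transpose_mat B * B)"
  define g where "g = real_of_int (gcd_mat A)"
  define p where "p = 1 / (2 * real ?r)"
  have dA: "0 < dA" using AC(1) by (simp add: dA_def)
  have dB: "0 < dB" unfolding dB_def by (rule det_gram_pos[OF ind])
  have g: "1 \<le> g" using gcd_mat_pos[OF A rows] unfolding g_def by linarith
  have "dA \<le> g\<^sup>2 * dB"
    using AC(2) unfolding dA_def g_def dB_def BC det_gram_int[symmetric]
    by (simp only: of_int_le_iff flip: of_int_power of_int_mult)
  hence "dA powr p \<le> (g\<^sup>2 * dB) powr p"
    using dA r by (intro powr_mono2) (auto simp: p_def)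
  also have "\<dots> = g powr (1 / real ?r) * dB powr p"
  proof -
    have "g\<^sup>2 = g powr 2" using g by simp
    moreover have "2 * p = 1 / real ?r" unfolding p_def by simp
    ultimately show ?thesis by (simp only: powr_mult powr_powr)
  qed
  \<comment> \<open>The comparison of determinants yields \<open>g powr (1 / real ?r)\<close>; as
    \<open>g\<close> and \<open>?r\<close> are at least 1, this is at most the factor
    \<open>g\<close> in the claim.\<close>
  also have "\<dots> \<le> g * dB powr p"
    using powr_mono[of "1 / real ?r" 1 g] g r by (intro mult_right_mono) auto
  finally have dAB: "dA powr p \<le> g * dB powr p" .
  have diff: "real_vec (w2 - x0) - real_vec (l2 - x0) = real_vec (w2 - l2)"
    using l w x0 by (intro eq_vecI) auto
  have Q: "Q_N l2 w2 B x0 =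
      {y \<in> carrier_vec ?r. real_vec (l2 - x0) \<le> B *\<^sub>v y \<and> B *\<^sub>v y \<le> real_vec (w2 - x0)}"
    using B by (simp add: Q_N_def)
  have "width (unit_vec ?r (?r - 1)) (Q_N l2 w2 B x0) \<le> ereal (K * vnorm (real_vec (w2 - l2)) / dB powr p)"
    unfolding diff[symmetric] Q
  proof (rule width_box_le[OF B r _ K])
    show "real_vec (l2 - x0) \<in> carrier_vec n" "real_vec (w2 - x0) \<in> carrier_vec n"
      using l w x0 by auto
    show "{y \<in> carrier_vec ?r. real_vec (l2 - x0) \<le> B *\<^sub>v y \<and> B *\<^sub>v y \<le> real_vec (w2 - x0)} \<noteq> {}"
      using ne unfolding Q .
    show "\<bar>y $ (?r - 1)\<bar> * dB powr p \<le> K * vnorm (B *\<^sub>v y)" if "y \<in> carrier_vec ?r" for y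
      using last[OF ind red carrier_matD(2)[OF B] that] unfolding dB_def p_def .
  qed (use dB in simp)
  also have "K * vnorm (real_vec (w2 - l2)) / dB powr p \<le> g * K * vnorm (real_vec (w2 - l2)) / dA powr p"
  proof -
    have "1 / dB powr p \<le> g / dA powr p"
      using dAB dA dB by (simp add: divide_simps)
    from mult_left_mono[OF this, of "K * vnorm (real_vec (w2 - l2))"] show ?thesis
      using K vnorm_ge_0[of "real_vec (w2 - l2)"] by (simp add: mult.commute mult.left_commute)
  qed
  finally show ?thesis by (simp add: g_def dA_def p_def)
qed

theorem proposition1:
  fixes m n :: nat and A :: "int mat" and l1 w1 l2 w2 :: "int vec"
  assumes "0 < m" and "5 \<le> n"
    and "A \<in> carrier_mat m n"
    and "l1 \<in> carrier_vec m" and "w1 \<in> carrier_vec m"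
    and "l2 \<in> carrier_vec n" and "w2 \<in> carrier_vec n"
    and "\<forall>i < n. l2 $ i < w2 $ i"
  shows
    "(\<forall>U. R_transform rkz_reduced A U \<and> Q_R A l1 w1 l2 w2 U \<noteq> {} \<longrightarrow>
        width (unit_vec n (n - 1)) (Q_R A l1 w1 l2 w2 U)
          \<le> ereal (sqrt (real n) * vnorm (real_vec ((w1 @\<^sub>v w2) - (l1 @\<^sub>v l2)))
                / real_of_int (det (A * transpose_mat A + 1\<^sub>m m)) powr (1 / (2 * real n)))) \<and>
     (indep_rows (real_mat A) \<and> m < n \<and> w1 = l1 \<longrightarrow>
       (\<forall>B x0. N_transform rkz_reduced A l1 B x0 \<and> Q_N l2 w2 B x0 \<noteq> {} \<longrightarrow>
          width (unit_vec (n - m) (n - m - 1)) (Q_N l2 w2 B x0)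
            \<le> ereal (real_of_int (gcd_mat A) * sqrt (real (n - m)) * vnorm (real_vec (w2 - l2))
                  / real_of_int (det (A * transpose_mat A)) powr (1 / (2 * real (n - m)))))) \<and>
     (\<forall>U. R_transform lll_reduced A U \<and> Q_R A l1 w1 l2 w2 U \<noteq> {} \<longrightarrow>
        width (unit_vec n (n - 1)) (Q_R A l1 w1 l2 w2 U)
          \<le> ereal (2 powr ((real n - 1) / 4) * vnorm (real_vec ((w1 @\<^sub>v w2) - (l1 @\<^sub>v l2)))
                / real_of_int (det (A * transpose_mat A + 1\<^sub>m m)) powr (1 / (2 * real n)))) \<and>
     (indep_rows (real_mat A) \<and> m < n \<and> w1 = l1 \<longrightarrow>
       (\<forall>B x0. N_transform lll_reduced A l1 B x0 \<and> Q_N l2 w2 B x0 \<noteq> {} \<longrightarrow>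
          width (unit_vec (n - m) (n - m - 1)) (Q_N l2 w2 B x0)
            \<le> ereal (real_of_int (gcd_mat A) * 2 powr ((real (n - m) - 1) / 4) * vnorm (real_vec (w2 - l2))
                  / real_of_int (det (A * transpose_mat A)) powr (1 / (2 * real (n - m))))))"
proof (intro conjI impI allI; elim conjE)
  \<comment> \<open>This block settles both bounds for \<open>Q_R\<close>, the next one both bounds
    for \<open>Q_N\<close>; only the constant and the coordinate bound differ between the two
    reductions.\<close>
  note R = width_Q_R_le[OF assms(3) _ assms(4,6,5,7)]
  have n: "0 < n" using assms(2) by simp
  fix U
  show "width (unit_vec n (n - 1)) (Q_R A l1 w1 l2 w2 U)
          \<le> ereal (sqrt (real n) * vnorm (real_vec ((w1 @\<^sub>v w2) - (l1 @\<^sub>v l2)))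
                / real_of_int (det (A * transpose_mat A + 1\<^sub>m m)) powr (1 / (2 * real n)))"
    if "R_transform rkz_reduced A U" "Q_R A l1 w1 l2 w2 U \<noteq> {}"
    using that
  proof (rule R[OF n])
    fix B :: "real mat" and y :: "real vec" assume "indep_cols B" "rkz_reduced B" "dim_col B = n" "y \<in> carrier_vec n"
    thus "\<bar>y $ (n - 1)\<bar> * det (transpose_mat B * B) powr (1 / (2 * real n)) \<le> sqrt (real n) * vnorm (B *\<^sub>v y)"
      using rkz_reduced_last_coord_le[of B y] n by simp
  qed simp
  show "width (unit_vec n (n - 1)) (Q_R A l1 w1 l2 w2 U)
          \<le> ereal (2 powr ((real n - 1) / 4) * vnorm (real_vec ((w1 @\<^sub>v w2) - (l1 @\<^sub>v l2)))
                / real_of_int (det (A * transpose_mat A + 1\<^sub>m m)) powr (1 / (2 * real n)))"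
    if "R_transform lll_reduced A U" "Q_R A l1 w1 l2 w2 U \<noteq> {}"
    using that
  proof (rule R[OF n])
    fix B :: "real mat" and y :: "real vec" assume "indep_cols B" "lll_reduced B" "dim_col B = n" "y \<in> carrier_vec n"
    thus "\<bar>y $ (n - 1)\<bar> * det (transpose_mat B * B) powr (1 / (2 * real n)) \<le> 2 powr ((real n - 1) / 4) * vnorm (B *\<^sub>v y)"
      using lll_reduced_last_coord_le[of B y] n by simp
  qed simp
next
  note N = width_Q_N_le[OF assms(3) _ _ assms(6,7)]
  fix B x0 assume ind: "indep_rows (real_mat A)" and mn: "m < n"
  have r: "0 < n - m" using mn by simp
  show "width (unit_vec (n - m) (n - m - 1)) (Q_N l2 w2 B x0)
            \<le> ereal (real_of_int (gcd_mat A) * sqrt (real (n - m)) * vnorm (real_vec (w2 - l2))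
                  / real_of_int (det (A * transpose_mat A)) powr (1 / (2 * real (n - m))))"
    if "N_transform rkz_reduced A l1 B x0" "Q_N l2 w2 B x0 \<noteq> {}"
    using that
  proof (rule N[OF ind mn])
    fix y :: "real vec" assume "indep_cols B" "rkz_reduced B" "dim_col B = n - m" "y \<in> carrier_vec (n - m)"
    thus "\<bar>y $ (n - m - 1)\<bar> * det (transpose_mat B * B) powr (1 / (2 * real (n - m)))
        \<le> sqrt (real (n - m)) * vnorm (B *\<^sub>v y)"
      using rkz_reduced_last_coord_le[of B y] r by simp
  qed simp
  show "width (unit_vec (n - m) (n - m - 1)) (Q_N l2 w2 B x0)
            \<le> ereal (real_of_int (gcd_mat A) * 2 powr ((real (n - m) - 1) / 4) * vnorm (real_vec (w2 - l2))
                  / real_of_int (det (A * transpose_mat A)) powr (1 / (2 * real (n - m))))"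
    if "N_transform lll_reduced A l1 B x0" "Q_N l2 w2 B x0 \<noteq> {}"
    using that
  proof (rule N[OF ind mn])
    fix y :: "real vec" assume "indep_cols B" "lll_reduced B" "dim_col B = n - m" "y \<in> carrier_vec (n - m)"
    thus "\<bar>y $ (n - m - 1)\<bar> * det (transpose_mat B * B) powr (1 / (2 * real (n - m)))
        \<le> 2 powr ((real (n - m) - 1) / 4) * vnorm (B *\<^sub>v y)"
      using lll_reduced_last_coord_le[of B y] r by simp
  qed simp
qed

end
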